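(* Let $\Re(\mu)>0$, $r=[\Re(\mu)]+1$, $\Re(\beta)>0$, $w\in\mathbb{C}\setminus\{0\}$, $1\le m\le q$, $0\le n\le p$ and $\Re(\beta)+\min_{1\le j\le m}\Re\left(\frac{\alpha b_j}{\beta_j}\right)>0$, and suppose that the operator on the right-hand side below is defined, i.e. $\Re(\beta-\mu)>0$ and $\Re(\beta-\mu)+\min_{1\le j\le m}\Re\left(\frac{\alpha b_j}{\beta_j}\right)>0$. Then $$D^{\mu}_{a+}\left(\mathcal{H}^{w;m,n;\alpha}_{a+;p,q;\beta}\phi\right)(x)=\left(\mathcal{H}^{w;m,n+2;\alpha}_{a+;p+2,q+2;\beta-\mu}\phi\right)(x),$$ where the $H$-function in the kernel of the operator on the right-hand side is $$H^{m,n+2}_{p+2,q+2}\left[w(x-t)^{\alpha}\left|\begin{array}{l}(1-\beta,\alpha),(1-\beta-r+\mu,\alpha),(a_j,\alpha_j)_{1,p}\\(b_j,\beta_j)_{1,q},(1-\beta-r+\mu,\alpha),(1-\beta+\mu,\alpha)\end{array}\right.\right].$$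
   Context: Throughout, $a\in\mathbb{R}$, $x>a$, $\alpha>0$, $\mu,\beta\in\mathbb{C}$; $[y]$ is the greatest integer not exceeding the real number $y$; $(a_j,\alpha_j)_{1,p}$ stands for the list $(a_1,\alpha_1),\dots,(a_p,\alpha_p)$, with $a_j,b_j\in\mathbb{C}$ and $\alpha_j,\beta_j>0$. Fox $H$-function: for $z\neq0$, $$H^{m,n}_{p,q}[z]=H^{m,n}_{p,q}\left[z\left|\begin{array}{c}(a_j,\alpha_j)_{1,p}\\(b_j,\beta_j)_{1,q}\end{array}\right.\right]=\frac1{2\pi i}\int_L\varphi(\xi)z^{\xi}\,d\xi,\qquad \varphi(\xi)=\frac{\prod_{j=1}^m\Gamma(b_j-\beta_j\xi)\prod_{j=1}^n\Gamma(1-a_j+\alpha_j\xi)}{\prod_{j=m+1}^q\Gamma(1-b_j+\beta_j\xi)\prod_{j=n+1}^p\Gamma(a_j-\alpha_j\xi)},$$ where $L$ is a suitable contour (running from $-i\infty$ to $+i\infty$, or a loop) separating the poles of $\Gamma(b_j-\beta_j\xi)$, $j\le m$ (to its right), from those of $\Gamma(1-a_j+\alpha_j\xi)$, $j\le n$ (to its left); as usual these two sets of poles are assumed disjoint and the integral is assumed to converge absolutely. Operators: $$\left(\mathcal{H}^{w;m,n;\alpha}_{a+;p,q;\beta}\varphi\right)(x)=\int_a^x(x-t)^{\beta-1}H^{m,n}_{p,q}[w(x-t)^{\alpha}]\varphi(t)\,dt,$$ defined under the conditions $\Re(\beta)>0$, $w\in\mathbb{C}\setminus\{0\}$, $1\le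 m\le q$, $0\le n\le p$, $\Re(\beta)+\min_{1\le j\le m}\Re(\alpha b_j/\beta_j)>0$, where (unless other parameters are displayed) the $H$-function has parameters $(a_j,\alpha_j)_{1,p}$, $(b_j,\beta_j)_{1,q}$; $$(I^{\mu}_{a+}f)(x)=\frac1{\Gamma(\mu)}\int_a^x\frac{f(t)}{(x-t)^{1-\mu}}\,dt\quad(\Re(\mu)>0),\qquad (D^{\mu}_{a+}f)(x)=\left(\frac{d}{dx}\right)^{r}(I^{r-\mu}_{a+}f)(x)\quad(\Re(\mu)>0,\ r=[\Re(\mu)]+1).$$ The function $\phi$ is any complex-valued integrable function for which the integrals occurring on both sides, including the iterated ones, exist and converge absolutely and for which the derivatives exist (in the usual sense of absolutely continuous functions on compact intervals $[a,b]$); the identity is an identity of functions of $x>a$ (almost everywhere). *)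

theory Defs
  imports "HOL-Complex_Analysis.Complex_Analysis"
begin

section \<open>The Fox H-function\<close>

text \<open>
  The parameter lists are \<open>A = [(a\<^sub>1,\<alpha>\<^sub>1),\<dots>,(a\<^sub>p,\<alpha>\<^sub>p)]\<close> and
  \<open>B = [(b\<^sub>1,\<beta>\<^sub>1),\<dots>,(b\<^sub>q,\<beta>\<^sub>q)]\<close>, so \<open>p\<close> and \<open>q\<close> are their lengths and the
  indices below are shifted by one.
\<close>

definition fox_phi ::
  "nat \<Rightarrow> nat \<Rightarrow> (complex \<times> real) list \<Rightarrow> (complex \<times> real) list \<Rightarrow> complex \<Rightarrow> complex" where
  "fox_phi m n A B \<xi> =
     ((\<Prod>j<m. Gamma (fst (B ! j) - of_real (snd (B ! j)) * \<xi>)) *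
      (\<Prod>j<n. Gamma (1 - fst (A ! j) + of_real (snd (A ! j)) * \<xi>))) /
     ((\<Prod>j=m..<length B. Gamma (1 - fst (B ! j) + of_real (snd (B ! j)) * \<xi>)) *
      (\<Prod>j=n..<length A. Gamma (fst (A ! j) - of_real (snd (A ! j)) * \<xi>)))"
  \<comment> \<open>At a pole \<open>Gamma\<close> is 0 and so is the quotient: the correct value of \<open>1/\<Gamma>\<close> in the
      denominator. The poles of the numerator never lie on a contour.\<close>

definition fox_right_poles :: "nat \<Rightarrow> (complex \<times> real) list \<Rightarrow> complex set" where
  "fox_right_poles m B =
     {\<xi>. \<exists>j<m. \<exists>k::nat. fst (B ! j) - of_real (snd (B ! j)) * \<xi> = - of_nat k}"

definition fox_left_poles :: "nat \<Rightarrow> (complex \<times> real) list \<Rightarrow> complex set" where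
  "fox_left_poles n A =
     {\<xi>. \<exists>j<n. \<exists>k::nat. 1 - fst (A ! j) + of_real (snd (A ! j)) * \<xi> = - of_nat k}"

text \<open>
  \<open>turns_around L c \<theta>\<close>: along the whole curve \<open>L : \<real> \<rightarrow> \<complex>\<close> the argument of \<open>L - c\<close> changes
  by \<open>2\<pi>\<theta>\<close> in total (for a path that is not closed, the real part of the winding number is
  the change of argument divided by \<open>2\<pi>\<close>). A point to the left of a curve running from
  \<open>\<gamma> - i\<infinity>\<close> to \<open>\<gamma> + i\<infinity>\<close> has \<open>\<theta> = 1/2\<close>, a point to the right has \<open>\<theta> = -1/2\<close>. For a loop that
  comes from and returns to \<open>+\<infinity>\<close> (lower end first) these values are \<open>0\<close> and \<open>-1\<close>, and for a
  loop that comes from and returns to \<open>-\<infinity>\<close> they are \<open>1\<close> and \<open>0\<close>.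
\<close>

definition turns_around :: "(real \<Rightarrow> complex) \<Rightarrow> complex \<Rightarrow> real \<Rightarrow> bool" where
  "turns_around L c \<theta> \<longleftrightarrow> c \<notin> range L \<and>
     ((\<lambda>T. Re (winding_number (L \<circ> linepath (- T) T) c)) \<longlongrightarrow> \<theta>) at_top"

definition separates_vertical :: "(real \<Rightarrow> complex) \<Rightarrow> complex set \<Rightarrow> complex set \<Rightarrow> bool" where
  "separates_vertical L P Q \<longleftrightarrow>
     (\<exists>\<gamma>. ((\<lambda>\<sigma>. Re (L \<sigma>)) \<longlongrightarrow> \<gamma>) at_bot \<and> ((\<lambda>\<sigma>. Re (L \<sigma>)) \<longlongrightarrow> \<gamma>) at_top) \<and>
     filterlim (\<lambda>\<sigma>. Im (L \<sigma>)) at_bot at_bot \<and> filterlim (\<lambda>\<sigma>. Im (L \<sigma>)) at_top at_top \<and>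
     (\<forall>c\<in>P. turns_around L c (1/2)) \<and> (\<forall>c\<in>Q. turns_around L c (-1/2))"

definition separates_right_loop :: "(real \<Rightarrow> complex) \<Rightarrow> complex set \<Rightarrow> complex set \<Rightarrow> bool" where
  "separates_right_loop L P Q \<longleftrightarrow>
     (\<exists>y1 y2. y1 < y2 \<and>
        ((\<lambda>\<sigma>. Im (L \<sigma>)) \<longlongrightarrow> y1) at_bot \<and> ((\<lambda>\<sigma>. Im (L \<sigma>)) \<longlongrightarrow> y2) at_top) \<and>
     filterlim (\<lambda>\<sigma>. Re (L \<sigma>)) at_top at_bot \<and> filterlim (\<lambda>\<sigma>. Re (L \<sigma>)) at_top at_top \<and>
     (\<forall>c\<in>P. turns_around L c 0) \<and> (\<forall>c\<in>Q. turns_around L c (-1))"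

definition separates_left_loop :: "(real \<Rightarrow> complex) \<Rightarrow> complex set \<Rightarrow> complex set \<Rightarrow> bool" where
  "separates_left_loop L P Q \<longleftrightarrow>
     (\<exists>y1 y2. y1 < y2 \<and>
        ((\<lambda>\<sigma>. Im (L \<sigma>)) \<longlongrightarrow> y1) at_bot \<and> ((\<lambda>\<sigma>. Im (L \<sigma>)) \<longlongrightarrow> y2) at_top) \<and>
     filterlim (\<lambda>\<sigma>. Re (L \<sigma>)) at_bot at_bot \<and> filterlim (\<lambda>\<sigma>. Re (L \<sigma>)) at_bot at_top \<and>
     (\<forall>c\<in>P. turns_around L c 1) \<and> (\<forall>c\<in>Q. turns_around L c 0)"

definition fox_contour ::
  "nat \<Rightarrow> nat \<Rightarrow> (complex \<times> real) list \<Rightarrow> (complex \<times> real) list \<Rightarrow> (real \<Rightarrow> complex) \<Rightarrow> bool" where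
  "fox_contour m n A B L \<longleftrightarrow>
     inj L \<and> (\<forall>T>0. L piecewise_C1_differentiable_on {- T..T}) \<and>
     (separates_vertical L (fox_left_poles n A) (fox_right_poles m B) \<or>
      separates_right_loop L (fox_left_poles n A) (fox_right_poles m B) \<or>
      separates_left_loop L (fox_left_poles n A) (fox_right_poles m B))"

definition fox_integrand ::
  "nat \<Rightarrow> nat \<Rightarrow> (complex \<times> real) list \<Rightarrow> (complex \<times> real) list \<Rightarrow> (real \<Rightarrow> complex) \<Rightarrow>
   complex \<Rightarrow> real \<Rightarrow> complex" where
  "fox_integrand m n A B L z \<sigma> =
     fox_phi m n A B (L \<sigma>) * z powr L \<sigma> * vector_derivative L (at \<sigma>)"

definition has_fox_H ::
  "nat \<Rightarrow> nat \<Rightarrow> (complex \<times> real) list \<Rightarrow> (complex \<times> real) list \<Rightarrow> complex \<Rightarrow> complex \<Rightarrow> bool" where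
  "has_fox_H m n A B z h \<longleftrightarrow>
     (\<exists>L. fox_contour m n A B L \<and> integrable lborel (fox_integrand m n A B L z) \<and>
          h = 1 / (2 * of_real pi * \<i>) * (LINT \<sigma>|lborel. fox_integrand m n A B L z \<sigma>))"

text \<open>
  The H-function does not carry the contour in its notation: it is defined at \<open>z\<close> if some
  suitable contour gives an absolutely convergent integral and the value does not depend on
  the choice of such a contour.
\<close>

definition fox_H_defined ::
  "nat \<Rightarrow> nat \<Rightarrow> (complex \<times> real) list \<Rightarrow> (complex \<times> real) list \<Rightarrow> complex \<Rightarrow> bool" where
  "fox_H_defined m n A B z \<longleftrightarrow>
     fox_left_poles n A \<inter> fox_right_poles m B = {} \<and> (\<exists>!h. has_fox_H m n A B z h)"

definition fox_H ::
  "nat \<Rightarrow> nat \<Rightarrow> (complex \<times> real) list \<Rightarrow> (complex \<times> real) list \<Rightarrow> complex \<Rightarrow> complex" where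
  "fox_H m n A B z = (THE h. has_fox_H m n A B z h)"

section \<open>The integral operators\<close>

definition fox_op ::
  "real \<Rightarrow> complex \<Rightarrow> nat \<Rightarrow> nat \<Rightarrow> real \<Rightarrow> complex \<Rightarrow>
   (complex \<times> real) list \<Rightarrow> (complex \<times> real) list \<Rightarrow> (real \<Rightarrow> complex) \<Rightarrow> real \<Rightarrow> complex" where
  "fox_op a w m n \<alpha> \<beta> A B \<phi> x =
     (LINT t:{a<..<x}|lborel.
        of_real (x - t) powr (\<beta> - 1) *
        fox_H m n A B (w * of_real ((x - t) powr \<alpha>)) * \<phi> t)"

definition rl_integral :: "complex \<Rightarrow> real \<Rightarrow> (real \<Rightarrow> complex) \<Rightarrow> real \<Rightarrow> complex" where
  "rl_integral \<mu> a f x =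
     1 / Gamma \<mu> * (LINT t:{a<..<x}|lborel. f t / of_real (x - t) powr (1 - \<mu>))"

definition rl_order :: "complex \<Rightarrow> nat" where
  "rl_order \<mu> = nat \<lfloor>Re \<mu>\<rfloor> + 1"

definition vderiv :: "(real \<Rightarrow> complex) \<Rightarrow> real \<Rightarrow> complex" where
  "vderiv f x = vector_derivative f (at x)"

definition rl_derivative :: "complex \<Rightarrow> real \<Rightarrow> (real \<Rightarrow> complex) \<Rightarrow> real \<Rightarrow> complex" where
  "rl_derivative \<mu> a f =
     (vderiv ^^ rl_order \<mu>) (rl_integral (of_nat (rl_order \<mu>) - \<mu>) a f)"

definition AC_on :: "real \<Rightarrow> real \<Rightarrow> (real \<Rightarrow> complex) \<Rightarrow> bool" where
  "AC_on c d f \<longleftrightarrow>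
     (\<forall>\<epsilon>>0. \<exists>\<delta>>0. \<forall>D. finite D \<longrightarrow>
        (\<forall>(u, v)\<in>D. c \<le> u \<and> u < v \<and> v \<le> d) \<longrightarrow>
        pairwise (\<lambda>I J. {fst I<..<snd I} \<inter> {fst J<..<snd J} = {}) D \<longrightarrow>
        (\<Sum>(u, v)\<in>D. v - u) < \<delta> \<longrightarrow> (\<Sum>(u, v)\<in>D. norm (f v - f u)) < \<epsilon>)"

text \<open>
  Existence of the derivative of order \<open>\<mu>\<close>: with \<open>r = rl_order \<mu>\<close>, the function
  \<open>g = I^(r-\<mu>) f\<close> is \<open>r - 1\<close> times differentiable on \<open>(a,\<infinity>)\<close> and the derivative of order
  \<open>r - 1\<close> is absolutely continuous on compact intervals; so the last derivative exists
  almost everywhere.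
\<close>

definition rl_derivative_exists :: "complex \<Rightarrow> real \<Rightarrow> (real \<Rightarrow> complex) \<Rightarrow> bool" where
  "rl_derivative_exists \<mu> a f \<longleftrightarrow>
     (let g = rl_integral (of_nat (rl_order \<mu>) - \<mu>) a f in
        (\<forall>k. Suc k < rl_order \<mu> \<longrightarrow> (\<forall>x>a. (vderiv ^^ k) g differentiable (at x))) \<and>
        (\<forall>c d. a < c \<longrightarrow> c < d \<longrightarrow> AC_on c d ((vderiv ^^ (rl_order \<mu> - 1)) g)))"

section \<open>Absolute convergence of the iterated integrals\<close>

text \<open>
  The operators with all factors replaced by their absolute values, the contour integral
  that represents the H-function along \<open>L\<close> included. Finiteness of \<open>fox_op_abs\<close> and of
  \<open>rl_integral_abs\<close> applied to \<open>fox_op_abs\<close> is the absolute convergence of the iterated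
  integrals. Integrability of the values of the H-function alone would be weaker: they can be
  integrable near \<open>x - t = 0\<close> through cancellation in the contour integral.
\<close>

definition fox_op_abs ::
  "real \<Rightarrow> complex \<Rightarrow> nat \<Rightarrow> nat \<Rightarrow> real \<Rightarrow> complex \<Rightarrow>
   (complex \<times> real) list \<Rightarrow> (complex \<times> real) list \<Rightarrow> (real \<Rightarrow> complex) \<Rightarrow>
   (real \<Rightarrow> complex) \<Rightarrow> real \<Rightarrow> ennreal" where
  "fox_op_abs a w m n \<alpha> \<beta> A B L \<phi> x =
     (\<integral>\<^sup>+ t\<in>{a<..<x}.
        ennreal (norm (of_real (x - t) powr (\<beta> - 1) * \<phi> t)) *
        (\<integral>\<^sup>+ \<sigma>. ennreal (norm (fox_integrand m n A B L (w * of_real ((x - t) powr \<alpha>)) \<sigma>)) \<partial>lborel)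
      \<partial>lborel)"

definition rl_integral_abs :: "complex \<Rightarrow> real \<Rightarrow> (real \<Rightarrow> ennreal) \<Rightarrow> real \<Rightarrow> ennreal" where
  "rl_integral_abs \<mu> a F x =
     (\<integral>\<^sup>+ t\<in>{a<..<x}. ennreal (norm (1 / complex_of_real (x - t) powr (1 - \<mu>))) * F t \<partial>lborel)"

end

theory Submission
  imports Defs
begin

text \<open>
  Let \<open>L\<close> be the contour of the H-function on the right-hand side and \<open>v = \<beta> - \<mu> + \<alpha> L\<close>. Both
  operators are convolutions of \<open>\<phi>\<close> with a superposition of power kernels: weights \<open>G\<close> and powers
  \<open>s powr (v - 1)\<close> on the right, weights \<open>G \<Gamma>(v) / \<Gamma>(v + \<mu>)\<close> and powers \<open>s powr (v + \<mu> - 1)\<close> on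
  the left. By the Beta integral both the fractional integral of order \<open>r - \<mu>\<close> of the left-hand side
  and the \<open>r\<close>-fold integral of the right-hand side have the weights \<open>G \<Gamma>(v) / \<Gamma>(v + r)\<close> and the
  powers \<open>s powr (v + r - 1)\<close>; differentiate \<open>r\<close> times.

  Two points need care. The contour given for the left-hand side is a priori a different one; but
  \<open>L\<close> also separates the smaller set of poles of the left-hand side, so it may be used there as soon
  as the integral along it converges. And the weights must be locally integrable: unless \<open>\<phi> = 0\<close> almost
  everywhere, absolute convergence of the right-hand side at one density point of \<open>\<phi>\<close> yields
  \<open>Re v > 0\<close> and integrability of \<open>\<bar>G\<bar> (1 + 1 / Re v)\<close>, and \<open>\<bar>\<Gamma>(v) / \<Gamma>(v + c)\<bar>\<close> is bounded by a
  multiple of \<open>1 + 1 / Re v\<close> for \<open>Re c > 0\<close>.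
\<close>

section \<open>Lebesgue differentiation of the indefinite integral\<close>

text \<open>On the right-hand side \<Gamma>(v) stands in the denominator, so the separation of poles
  says nothing about the sign of Re v along \<open>L\<close>. Where Re v \<le> 0, the power s powr
  (v - 1) is not integrable at 0 and the Beta integral breaks down; where Re v comes close to 0, the
  Beta function may grow like 1 / Re v. Both defects have to be excluded by the convergence of the
  right-hand side alone, which sees the singularity of the kernel only through the mass of \<phi>
  just before x. If the integral of norm (\<phi> t) has the nonzero derivative norm (\<phi> x) at x,
  this mass is at least c * b on an interval of length b. Since u powr (p - 1) is nonincreasing for
  p \<le> 1, its integral against such a mass is at least c times \<delta> powr p / p, or infinite
  if p \<le> 0. Lebesgue differentiation therefore enters twice: to find this point x, and for the
  last of the r derivatives, the only one obtained merely almost everywhere.\<close>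

lemma negligible_sparse_difference_quotients:
  fixes f :: "real \<Rightarrow> 'a::euclidean_space"
  assumes f: "f integrable_on cbox a b" and \<epsilon>: "\<epsilon> > 0"
  defines "E \<equiv> {x \<in> {a<..<b}. \<forall>d>0. \<exists>u v. u < v \<and> v - u < d \<and> x \<in> {u..v} \<and>
      norm ((v - u) *\<^sub>R f x - integral {u..v} f) > \<epsilon> * (v - u)}"
  shows "negligible E"
  unfolding negligible_outer_le
proof (intro allI impI)
  fix \<eta> :: real assume \<eta>: "\<eta> > 0"
  \<comment> \<open>Henstock's lemma bounds the total error of a fine tagged partial division. An
    interval that puts x into \<open>E\<close> errs by more than \<epsilon> times its length, so
    disjoint intervals of this kind have total length below \<eta>. Vitali's theorem covers almost
    all of \<open>E\<close> by them.\<close>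
  obtain \<gamma> where \<gamma>: "gauge \<gamma>"
    and small: "\<And>p. \<lbrakk>p tagged_partial_division_of (cbox a b); \<gamma> fine p\<rbrakk> \<Longrightarrow>
             sum (\<lambda>(x,k). norm (Henstock_Kurzweil_Integration.content k *\<^sub>R f x - integral k f)) p < \<epsilon> * \<eta>"
    by (rule Henstock_lemma[OF f mult_pos_pos[OF \<epsilon> \<eta>]]) (erule that, blast)
  define K where "K = {(x, u, v). x \<in> {u..v} \<and> u < v \<and> {u..v} \<subseteq> \<gamma> x \<and> {u..v} \<subseteq> {a..b} \<and>
      norm ((v - u) *\<^sub>R f x - integral {u..v} f) > \<epsilon> * (v - u)}"
  define m where "m = (\<lambda>(x :: real, u, v). (u + v) / 2 :: real)"
  define \<rho> where "\<rho> = (\<lambda>(x :: real, u, v). (v - u) / 2 :: real)"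
  have cb: "cball (m (x, u, v)) (\<rho> (x, u, v)) = {u..v}" for x u v
    unfolding m_def \<rho>_def by (auto simp: cball_eq_atLeastAtMost field_simps)
  have \<rho>0: "i \<in> K \<Longrightarrow> 0 < \<rho> i" for i
    by (auto simp: K_def \<rho>_def)
  have cov: "\<exists>i. i \<in> K \<and> x \<in> cball (m i) (\<rho> i) \<and> \<rho> i < d" if x: "x \<in> E" and d: "0 < d" for x d
  proof -
    obtain e where e: "e > 0" "ball x e \<subseteq> \<gamma> x"
      using \<gamma> gaugeD openE by metis
    have "x \<in> {a<..<b}" using x unfolding E_def by (elim CollectE conjE)
    \<comment> \<open>An interval through x that is shorter than \<open>d'\<close> stays inside
      [a, b] and inside the ball that the gauge allows.\<close>
    define d' where "d' = min (min d e) (min (x - a) (b - x))"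
    have d': "d' > 0" "d' \<le> d" "d' \<le> e" "d' \<le> x - a" "d' \<le> b - x"
      using d e \<open>x \<in> {a<..<b}\<close> by (simp_all add: d'_def)
    obtain u v where uv: "u < v" "v - u < d'" "x \<in> {u..v}"
        "norm ((v - u) *\<^sub>R f x - integral {u..v} f) > \<epsilon> * (v - u)"
      using x d'(1) unfolding E_def by blast
    have "{u..v} \<subseteq> ball x e"
      using uv d' by (auto simp: dist_real_def)
    then have "(x, u, v) \<in> K"
      using uv d' e(2) by (auto simp: K_def)
    moreover have "x \<in> cball (m (x, u, v)) (\<rho> (x, u, v))"
      unfolding cb by (rule uv(3))
    moreover have "\<rho> (x, u, v) < d"
      using uv d' by (simp add: \<rho>_def)
    ultimately show ?thesis by blast
  qed
  obtain C where C: "countable C" "C \<subseteq> K"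
     "pairwise (\<lambda>i j. disjnt (cball (m i) (\<rho> i)) (cball (m j) (\<rho> j))) C"
     "negligible (E - (\<Union>i\<in>C. cball (m i) (\<rho> i)))"
    using Vitali_covering_theorem_cballs[OF \<rho>0 cov] by blast
  \<comment> \<open>Henstock's lemma speaks of finite families only; a bound uniform over finite
    subfamilies passes to the countable union.\<close>
  have fin: "measure lebesgue (\<Union>i\<in>D. cball (m i) (\<rho> i)) \<le> \<eta>" if D: "finite D" "D \<subseteq> C" for D
  proof -
    define p where "p = (\<lambda>i. (fst i, cball (m i) (\<rho> i))) ` D"
    have inj: "inj_on (\<lambda>i. (fst i, cball (m i) (\<rho> i))) D"
    proof (rule inj_onI)
      fix i j assume ij: "i \<in> D" "j \<in> D" "(fst i, cball (m i) (\<rho> i)) = (fst j, cball (m j) (\<rho> j))"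
      have "i \<in> K" using ij(1) D C(2) by blast
      then have "m i \<in> cball (m i) (\<rho> i)"
        using \<rho>0[of i] by simp
      then have "\<not> disjnt (cball (m i) (\<rho> i)) (cball (m j) (\<rho> j))"
        using ij(3) unfolding disjnt_def by blast
      moreover have "i \<in> C" "j \<in> C" using ij D by blast+
      ultimately show "i = j"
        using C(3) by (blast dest: pairwiseD)
    qed
    have "(\<Sum>i\<in>D. \<epsilon> * measure lebesgue (cball (m i) (\<rho> i)))
      \<le> (\<Sum>i\<in>D. (\<lambda>(x,k). norm (Henstock_Kurzweil_Integration.content k *\<^sub>R f x - integral k f)) (fst i, cball (m i) (\<rho> i)))"
    proof (rule sum_mono)
      fix i assume "i \<in> D"
      then have "i \<in> K" using D C by blast
      then show "\<epsilon> * measure lebesgue (cball (m i) (\<rho> i))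
        \<le> (\<lambda>(x,k). norm (Henstock_Kurzweil_Integration.content k *\<^sub>R f x - integral k f)) (fst i, cball (m i) (\<rho> i))"
        by (cases i) (auto simp: cb K_def)
    qed
    also have "\<dots> = sum (\<lambda>(x,k). norm (Henstock_Kurzweil_Integration.content k *\<^sub>R f x - integral k f)) p"
      unfolding p_def by (subst sum.reindex[OF inj]) simp
    also have "\<dots> < \<epsilon> * \<eta>"
    proof (rule small)
      show "p tagged_partial_division_of cbox a b"
        unfolding tagged_partial_division_of_def
      proof (intro conjI allI impI)
        show "finite p" using D by (simp add: p_def)
        fix x k assume "(x, k) \<in> p"
        then obtain u v where uv: "(x, u, v) \<in> D" "k = {u..v}"
          unfolding p_def by (force simp: cb)
        then have "(x, u, v) \<in> K" using D C by blast
        then show "x \<in> k" "k \<subseteq> cbox a b"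
          unfolding K_def uv(2) cbox_interval by blast+
        show "\<exists>a b. k = cbox a b"
          unfolding uv(2) cbox_interval by blast
      next
        fix x1 k1 x2 k2 assume *: "(x1, k1) \<in> p \<and> (x2, k2) \<in> p \<and> (x1, k1) \<noteq> (x2, k2)"
        then obtain i j where ij: "i \<in> D" "j \<in> D" "k1 = cball (m i) (\<rho> i)" "k2 = cball (m j) (\<rho> j)" "i \<noteq> j"
          unfolding p_def by blast
        then have "i \<in> C" "j \<in> C" using D by blast+
        then have "disjnt k1 k2"
          unfolding ij(3,4) using C(3) ij(5) by (blast dest: pairwiseD)
        then show "interior k1 \<inter> interior k2 = {}"
          unfolding disjnt_def using interior_subset[of k1] interior_subset[of k2] by blast
      qed
      show "\<gamma> fine p"
        unfolding fine_def
      proof clarify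
        fix x k y assume "(x, k) \<in> p" and y: "y \<in> k"
        then obtain u v where uv: "(x, u, v) \<in> D" "k = {u..v}"
          unfolding p_def by (force simp: cb)
        then have "(x, u, v) \<in> K" using D C by blast
        then show "y \<in> \<gamma> x" using y uv by (auto simp: K_def)
      qed
    qed
    finally have "(\<Sum>i\<in>D. measure lebesgue (cball (m i) (\<rho> i))) < \<eta>"
      using \<epsilon> by (simp flip: sum_distrib_left)
    moreover have "measure lebesgue (\<Union>i\<in>D. cball (m i) (\<rho> i)) \<le> (\<Sum>i\<in>D. measure lebesgue (cball (m i) (\<rho> i)))"
      using D(1) by (intro measure_UNION_le) auto
    ultimately show ?thesis by linarith
  qed
  have U: "(\<Union>i\<in>C. cball (m i) (\<rho> i)) \<in> lmeasurable" "measure lebesgue (\<Union>i\<in>C. cball (m i) (\<rho> i)) \<le> \<eta>"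
  proof -
    have "\<Union> ((\<lambda>i. cball (m i) (\<rho> i)) ` C) \<in> lmeasurable \<and> measure lebesgue (\<Union> ((\<lambda>i. cball (m i) (\<rho> i)) ` C)) \<le> \<eta>"
    proof (rule conjI)
      show "\<Union> ((\<lambda>i. cball (m i) (\<rho> i)) ` C) \<in> lmeasurable"
        by (rule fmeasurable_UN_bound[OF C(1), of _ _ \<eta>]) (use fin in auto)
      show "measure lebesgue (\<Union> ((\<lambda>i. cball (m i) (\<rho> i)) ` C)) \<le> \<eta>"
        by (rule measure_UN_bound[OF C(1)]) (use fin in auto)
    qed
    then show "(\<Union>i\<in>C. cball (m i) (\<rho> i)) \<in> lmeasurable" "measure lebesgue (\<Union>i\<in>C. cball (m i) (\<rho> i)) \<le> \<eta>" by auto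
  qed
  let ?T = "(E - (\<Union>i\<in>C. cball (m i) (\<rho> i))) \<union> (\<Union>i\<in>C. cball (m i) (\<rho> i))"
  have "measure lebesgue ?T \<le> measure lebesgue (E - (\<Union>i\<in>C. cball (m i) (\<rho> i))) + measure lebesgue (\<Union>i\<in>C. cball (m i) (\<rho> i))"
    by (intro measure_Un_le fmeasurableD negligible_imp_measurable C(4) U(1))
  then have "measure lebesgue ?T \<le> \<eta>"
    using U(2) negligible_imp_measure0[OF C(4)] by linarith
  moreover have "?T \<in> lmeasurable"
    by (rule fmeasurable.Un[OF negligible_imp_measurable[OF C(4)] U(1)])
  ultimately show "\<exists>T. E \<subseteq> T \<and> T \<in> lmeasurable \<and> measure lebesgue T \<le> \<eta>"
    by (intro exI[of _ ?T]) auto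
qed

text \<open>Countably many tolerances 1 / Suc n suffice. The intervals in the exceptional sets
  merely contain x, so taking x as the left or the right endpoint controls both one-sided difference
  quotients.\<close>

lemma AE_integral_has_vector_derivative:
  fixes f :: "real \<Rightarrow> 'a::euclidean_space"
  assumes f: "f integrable_on {a..b}"
  shows "AE x in lborel. a < x \<and> x < b \<longrightarrow>
    ((\<lambda>y. integral {a..y} f) has_vector_derivative f x) (at x)"
proof -
  define E where "E = (\<lambda>\<epsilon>. {x \<in> {a<..<b}. \<forall>d>0. \<exists>u v. u < v \<and> v - u < d \<and> x \<in> {u..v} \<and>
      norm ((v - u) *\<^sub>R f x - integral {u..v} f) > \<epsilon> * (v - u)})"
  have "negligible (\<Union>n. E (1 / Suc n))"
  proof (rule negligible_Union_nat)
    show "negligible (E (1 / Suc n))" for n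
      unfolding E_def using negligible_sparse_difference_quotients[of f a b "1 / Suc n"] f by simp
  qed
  \<comment> \<open>A negligible set is null for the completed measure; \<open>N\<close> is a Borel
    null set around it.\<close>
  then obtain N where N: "N \<in> null_sets lborel" "(\<Union>n. E (1 / Suc n)) \<subseteq> N"
    by (meson negligible_iff_null_sets null_sets_completion_iff2)
  have der: "((\<lambda>y. integral {a..y} f) has_vector_derivative f x) (at x)"
    if x: "a < x" "x < b" "x \<notin> N" for x
    unfolding has_vector_derivative_def has_derivative_at_alt
  proof (intro conjI allI impI bounded_linear_scaleR_left)
    fix e :: real assume "e > 0"
    then obtain n where n: "1 / Suc n < e"
      using nat_approx_posE by metis
    have "x \<notin> E (1 / Suc n)" using N x by auto
    then obtain d where d: "d > 0" and
      dd: "\<And>u v. \<lbrakk>u < v; v - u < d; x \<in> {u..v}\<rbrakk> \<Longrightarrow> norm ((v - u) *\<^sub>R f x - integral {u..v} f) \<le> 1 / Suc n * (v - u)"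
    proof -
      have "\<not> (\<forall>d>0. \<exists>u v. u < v \<and> v - u < d \<and> x \<in> {u..v} \<and>
          norm ((v - u) *\<^sub>R f x - integral {u..v} f) > 1 / Suc n * (v - u))"
        using x(1,2) \<open>x \<notin> E (1 / Suc n)\<close> unfolding E_def by simp
      then show ?thesis using that by (meson not_le)
    qed
    define d' where "d' = min d (min (x - a) (b - x))"
    have d': "d' > 0" "d' \<le> d" "d' \<le> x - a" "d' \<le> b - x"
      using d x(1,2) by (simp_all add: d'_def)
    have "norm (integral {a..y} f - integral {a..x} f - (y - x) *\<^sub>R f x) \<le> e * norm (y - x)"
      if y: "norm (y - x) < d'" for y
    proof -
      have comb: "integral {a..u} f + integral {u..v} f = integral {a..v} f" if "a \<le> u" "u \<le> v" "v \<le> b" for u v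
        using that by (intro Henstock_Kurzweil_Integration.integral_combine integrable_subinterval_real[OF f]) auto
      consider "y = x" | "x < y" | "y < x" by linarith
      then show ?thesis
      proof cases
        case 2
        have "norm (integral {a..y} f - integral {a..x} f - (y - x) *\<^sub>R f x) = norm ((y - x) *\<^sub>R f x - integral {x..y} f)"
        proof -
          have "integral {a..y} f - integral {a..x} f - (y - x) *\<^sub>R f x = - ((y - x) *\<^sub>R f x - integral {x..y} f)"
            using comb[of x y] 2 y x d' by (auto simp: algebra_simps)
          then show ?thesis by (metis norm_minus_cancel)
        qed
        also have "\<dots> \<le> 1 / Suc n * (y - x)"
          using 2 y d' by (intro dd) auto
        also have "\<dots> \<le> e * (y - x)" using n 2 by (intro mult_right_mono) auto
        finally show ?thesis using 2 by simp
      next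
        case 3
        have "integral {a..y} f - integral {a..x} f - (y - x) *\<^sub>R f x = (x - y) *\<^sub>R f x - integral {y..x} f"
          using comb[of y x] 3 y x d' by (auto simp: algebra_simps)
        moreover have "norm ((x - y) *\<^sub>R f x - integral {y..x} f) \<le> 1 / Suc n * (x - y)"
          using 3 y d' by (intro dd) auto
        moreover have "1 / Suc n * (x - y) \<le> e * (x - y)" using n 3 by (intro mult_right_mono) auto
        ultimately show ?thesis using 3 by simp
      qed simp
    qed
    then show "\<exists>d>0. \<forall>y. norm (y - x) < d \<longrightarrow>
        norm (integral {a..y} f - integral {a..x} f - (y - x) *\<^sub>R f x) \<le> e * norm (y - x)"
      using d'(1) by blast
  qed
  have "AE x in lborel. x \<notin> N" using N(1) by (rule AE_not_in)
  then show ?thesis by eventually_elim (use der in auto)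
qed

section \<open>Convolutions of power kernels\<close>

definition convolution :: "(real \<Rightarrow> complex) \<Rightarrow> (real \<Rightarrow> complex) \<Rightarrow> real \<Rightarrow> complex" where
  "convolution f g x = (LINT t|lborel. f (x - t) * g t)"

text \<open>The extension by 0 turns integrals over (a, x) into convolutions on the whole line. The
  exponential form gives measurability jointly in the exponent and in s.\<close>

definition power_kernel :: "complex \<Rightarrow> real \<Rightarrow> complex" where
  "power_kernel c s = (if 0 < s then exp ((c - 1) * of_real (ln s)) else 0)"

text \<open>The shape of s powr (\<beta> - 1) times an H-function once the contour is parametrized
  by \<sigma>.\<close>

definition power_mixture :: "(real \<Rightarrow> complex) \<Rightarrow> (real \<Rightarrow> complex) \<Rightarrow> real \<Rightarrow> complex" where
  "power_mixture G e s = (LINT \<sigma>|lborel. G \<sigma> * power_kernel (e \<sigma>) s)"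

lemma power_kernel_measurable [measurable (raw)]:
  assumes [measurable]: "f \<in> borel_measurable M" "g \<in> borel_measurable M"
  shows "(\<lambda>x. power_kernel (f x) (g x)) \<in> borel_measurable M"
proof -
  have [measurable]: "(exp :: complex \<Rightarrow> complex) \<in> borel_measurable borel"
    by (intro borel_measurable_continuous_onI continuous_intros)
  show ?thesis unfolding power_kernel_def by measurable
qed

lemma power_mixture_measurable [measurable]:
  assumes [measurable]: "G \<in> borel_measurable borel" "e \<in> borel_measurable borel"
  shows "power_mixture G e \<in> borel_measurable borel"
  unfolding power_mixture_def by measurable

lemma power_kernel_nonpos [simp]: "s \<le> 0 \<Longrightarrow> power_kernel c s = 0"
  by (simp add: power_kernel_def)

lemma power_mixture_nonpos [simp]: "s \<le> 0 \<Longrightarrow> power_mixture G e s = 0"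
  by (simp add: power_mixture_def)

lemma Gamma_nonzero:
  fixes z :: complex
  assumes "Re z > 0"
  shows "Gamma z \<noteq> 0"
  using assms by (auto simp: Gamma_eq_zero_iff elim!: nonpos_Ints_cases)

lemma power_kernel_eq_powr: "s > 0 \<Longrightarrow> power_kernel c s = of_real s powr (c - 1)"
  by (simp add: power_kernel_def powr_def Ln_of_real)

lemma norm_power_kernel: "norm (power_kernel c s) = (if 0 < s then s powr (Re c - 1) else 0)"
  by (simp add: power_kernel_def powr_def)

lemma power_kernel_one: "power_kernel 1 s = (if 0 < s then 1 else 0)"
  by (simp add: power_kernel_def)

lemma power_kernel_add: "0 < s \<Longrightarrow> power_kernel (c + d) s = power_kernel c s * of_real s powr d"
  by (simp add: power_kernel_def powr_def Ln_of_real algebra_simps flip: exp_add)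

section \<open>Translations, convolutions and Fubini\<close>

lemma nn_integral_reflect:
  fixes f :: "real \<Rightarrow> ennreal"
  assumes [measurable]: "f \<in> borel_measurable borel"
  shows "(\<integral>\<^sup>+t. f (x - t) \<partial>lborel) = (\<integral>\<^sup>+t. f t \<partial>lborel)"
  using nn_integral_real_affine[of f "-1" x] by simp

lemma nn_integral_shift:
  fixes f :: "real \<Rightarrow> ennreal"
  assumes [measurable]: "f \<in> borel_measurable borel"
  shows "(\<integral>\<^sup>+t. f (t - x) \<partial>lborel) = (\<integral>\<^sup>+t. f t \<partial>lborel)"
  using nn_integral_real_affine[of f 1 "-x"] by simp

lemma integral_shift:
  fixes f :: "real \<Rightarrow> complex"
  shows "(LINT t|lborel. f (t - x)) = (LINT t|lborel. f t)"
  using lborel_integral_real_affine[of 1 f "-x"] by simp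

lemma convolution_eq_0:
  assumes "\<And>s. s \<le> 0 \<Longrightarrow> f s = 0" "\<And>t. t \<le> a \<Longrightarrow> g t = 0" "x \<le> a"
  shows "convolution f g x = 0"
proof -
  have "(\<lambda>t. f (x - t) * g t) = (\<lambda>t. 0)"
  proof
    fix t show "f (x - t) * g t = 0"
      using assms(1)[of "x - t"] assms(2)[of t] assms(3) by (cases "t \<le> a") auto
  qed
  then show ?thesis by (simp add: convolution_def)
qed

text \<open>Fubini in t and \<tau>; the substitution u = \<tau> - t brings the absolute double
  integral into the form of \<open>fin\<close>. The integrability part is kept because it later
  permits the next primitive to be taken.\<close>

lemma convolution_assoc:
  assumes [measurable]: "f \<in> borel_measurable borel" "g \<in> borel_measurable borel" "h \<in> borel_measurable borel"
  assumes fin: "(\<integral>\<^sup>+t. (\<integral>\<^sup>+u. ennreal (norm (f (x - t - u) * g u)) \<partial>lborel) * ennreal (norm (h t)) \<partial>lborel) < \<infinity>"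
  shows "integrable lborel (\<lambda>\<tau>. f (x - \<tau>) * convolution g h \<tau>) \<and> convolution f (convolution g h) x = convolution (convolution f g) h x"
proof (rule conjI)
  define P where "P = (\<lambda>t \<tau>. f (x - \<tau>) * g (\<tau> - t) * h t)"
  have [measurable]: "case_prod P \<in> borel_measurable (lborel \<Otimes>\<^sub>M lborel)"
    unfolding P_def by measurable
  have "(\<integral>\<^sup>+z. ennreal (norm (case_prod P z)) \<partial>(lborel \<Otimes>\<^sub>M lborel))
      = (\<integral>\<^sup>+t. \<integral>\<^sup>+\<tau>. ennreal (norm (P t \<tau>)) \<partial>lborel \<partial>lborel)"
    by (subst lborel.nn_integral_fst[symmetric]) auto
  also have "\<dots> = (\<integral>\<^sup>+t. (\<integral>\<^sup>+\<tau>. ennreal (norm (f (x - t - (\<tau> - t)) * g (\<tau> - t))) \<partial>lborel) * ennreal (norm (h t)) \<partial>lborel)"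
    by (intro nn_integral_cong, subst nn_integral_multc[symmetric])
      (auto simp: P_def norm_mult ennreal_mult)
  also have "\<dots> = (\<integral>\<^sup>+t. (\<integral>\<^sup>+u. ennreal (norm (f (x - t - u) * g u)) \<partial>lborel) * ennreal (norm (h t)) \<partial>lborel)"
    by (intro nn_integral_cong arg_cong2[where f = "(*)"] refl nn_integral_shift) measurable
  finally have int: "integrable (lborel \<Otimes>\<^sub>M lborel) (case_prod P)"
    using fin by (intro integrableI_bounded) auto
  have 1: "(LINT t|lborel. P t \<tau>) = f (x - \<tau>) * convolution g h \<tau>" for \<tau>
    by (simp add: P_def convolution_def mult.assoc)
  have 2: "(LINT \<tau>|lborel. P t \<tau>) = convolution f g (x - t) * h t" for t
  proof -
    have "(LINT \<tau>|lborel. P t \<tau>) = (LINT \<tau>|lborel. f (x - t - (\<tau> - t)) * g (\<tau> - t)) * h t"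
      by (simp add: P_def)
    also have "(LINT \<tau>|lborel. f (x - t - (\<tau> - t)) * g (\<tau> - t)) = convolution f g (x - t)"
      unfolding convolution_def by (rule integral_shift)
    finally show ?thesis .
  qed
  show "integrable lborel (\<lambda>\<tau>. f (x - \<tau>) * convolution g h \<tau>)"
    using lborel_pair.integrable_snd[OF int] by (simp add: 1)
  show "convolution f (convolution g h) x = convolution (convolution f g) h x"
    using lborel_pair.Fubini_integral[OF int] unfolding 1 2 by (simp add: convolution_def)
qed

text \<open>Euler's integral, read as the Laplace transform of a power kernel at 1. It identifies
  the constant in the convolution of two kernels.\<close>

lemma has_bochner_integral_power_kernel_exp:
  assumes "Re z > 0"
  shows "has_bochner_integral lborel (\<lambda>t. power_kernel z t * of_real (exp (- t))) (Gamma z)"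
  unfolding has_bochner_integral_iff
proof (rule conjI)
  let ?g = "\<lambda>t. complex_of_real t powr (z - 1) / of_real (exp t)"
  have eq: "indicator {0<..} t *\<^sub>R ?g t = power_kernel z t * of_real (exp (- t))" for t :: real
    by (auto simp: indicator_def power_kernel_eq_powr exp_minus divide_inverse of_real_inverse)
  have abs: "set_integrable lborel {0<..} ?g"
    using absolutely_integrable_Gamma_integral'[OF assms]
    unfolding set_integrable_def eq by (subst (asm) integrable_completion) auto
  then show "integrable lborel (\<lambda>t. power_kernel z t * of_real (exp (- t)))"
    by (simp add: set_integrable_def eq)
  from set_borel_integral_eq_integral(2)[OF abs]
  show "(LINT t|lborel. power_kernel z t * of_real (exp (- t))) = Gamma z"
    using Gamma_integral_complex'[OF assms]
    by (simp add: set_lebesgue_integral_def eq integral_unique)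
qed

lemma power_kernel_mult: "0 < s \<Longrightarrow> power_kernel c (s * u) = power_kernel c s * power_kernel c u"
  by (auto simp: power_kernel_def zero_less_mult_iff ln_mult distrib_left exp_add)

lemma power_kernel_power_kernel_scale: "0 < s \<Longrightarrow> power_kernel c s * power_kernel e s * of_real s = power_kernel (c + e) s"
proof -
  assume s: "0 < s"
  have "complex_of_real s = exp (of_real (ln s))"
    using s by (metis exp_ln exp_of_real)
  then have "power_kernel c s * power_kernel e s * of_real s = exp ((c-1) * of_real (ln s)) * exp ((e-1) * of_real (ln s)) * exp (of_real (ln s))"
    using s by (simp add: power_kernel_def)
  also have "\<dots> = power_kernel (c + e) s"
    using s by (simp add: power_kernel_def algebra_simps flip: exp_add)
  finally show ?thesis .
qed

text \<open>Homogeneity, by the substitution t = s * u: only the value at 1 remains to be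
  found.\<close>

lemma convolution_power_kernel_scale:
  assumes "0 < s"
  shows "convolution (power_kernel c) (power_kernel e) s = power_kernel (c + e) s * convolution (power_kernel c) (power_kernel e) 1"
proof -
  have "convolution (power_kernel c) (power_kernel e) s = s *\<^sub>R (LINT u|lborel. power_kernel c (s - (0 + s * u)) * power_kernel e (0 + s * u))"
    unfolding convolution_def using lborel_integral_real_affine[of s "\<lambda>t. power_kernel c (s - t) * power_kernel e t" 0] assms by simp
  also have "(\<lambda>u. power_kernel c (s - (0 + s * u)) * power_kernel e (0 + s * u)) = (\<lambda>u. (power_kernel c s * power_kernel e s) * (power_kernel c (1 - u) * power_kernel e u))"
  proof
    fix u show "power_kernel c (s - (0 + s * u)) * power_kernel e (0 + s * u) = (power_kernel c s * power_kernel e s) * (power_kernel c (1 - u) * power_kernel e u)"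
      using power_kernel_mult[OF assms, of c "1 - u"] power_kernel_mult[OF assms, of e u] by (simp add: algebra_simps)
  qed
  also have "s *\<^sub>R (LINT u|lborel. (power_kernel c s * power_kernel e s) * (power_kernel c (1 - u) * power_kernel e u)) = (power_kernel c s * power_kernel e s * of_real s) * convolution (power_kernel c) (power_kernel e) 1"
    by (simp add: convolution_def scaleR_conv_of_real)
  finally show ?thesis by (simp add: power_kernel_power_kernel_scale[OF assms])
qed

lemma convolution_power_kernel_nonpos: "s \<le> 0 \<Longrightarrow> convolution (power_kernel c) (power_kernel e) s = 0"
  by (rule convolution_eq_0[of _ 0]) auto

text \<open>By homogeneity the convolution is a constant times \<open>power_kernel (c + e)\<close>.
  Since exp (- (\<tau> - t)) * exp (- t) = exp (- \<tau>), its Laplace transform at 1 is \<Gamma>(c)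
  \<Gamma>(e) by Fubini, and also the constant times \<Gamma>(c + e).\<close>

lemma convolution_power_kernel:
  assumes c: "Re c > 0" and e: "Re e > 0"
  shows "convolution (power_kernel c) (power_kernel e) s = Beta c e * power_kernel (c + e) s"
proof -
  let ?E = "\<lambda>t. complex_of_real (exp (- t))"
  define P where "P = (\<lambda>t \<tau>. power_kernel c (\<tau> - t) * ?E (\<tau> - t) * (power_kernel e t * ?E t))"
  note Gc = has_bochner_integral_power_kernel_exp[OF c, unfolded has_bochner_integral_iff]
    and Ge = has_bochner_integral_power_kernel_exp[OF e, unfolded has_bochner_integral_iff]
  have [measurable]: "case_prod P \<in> borel_measurable (lborel \<Otimes>\<^sub>M lborel)"
    unfolding P_def by measurable
  have "(\<integral>\<^sup>+z. ennreal (norm (case_prod P z)) \<partial>(lborel \<Otimes>\<^sub>M lborel))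
      = (\<integral>\<^sup>+t. \<integral>\<^sup>+\<tau>. ennreal (norm (P t \<tau>)) \<partial>lborel \<partial>lborel)"
    by (subst lborel.nn_integral_fst[symmetric]) auto
  also have "\<dots> = (\<integral>\<^sup>+t. (\<integral>\<^sup>+\<tau>. ennreal (norm (power_kernel c (\<tau> - t) * ?E (\<tau> - t))) \<partial>lborel) * ennreal (norm (power_kernel e t * ?E t)) \<partial>lborel)"
    by (intro nn_integral_cong, subst nn_integral_multc[symmetric])
      (auto simp: P_def norm_mult ennreal_mult)
  also have "\<dots> = (\<integral>\<^sup>+t. (\<integral>\<^sup>+\<tau>. ennreal (norm (power_kernel c \<tau> * ?E \<tau>)) \<partial>lborel) * ennreal (norm (power_kernel e t * ?E t)) \<partial>lborel)"
    by (intro nn_integral_cong arg_cong2[where f = "(*)"] refl nn_integral_shift) measurable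
  also have "\<dots> = (\<integral>\<^sup>+\<tau>. ennreal (norm (power_kernel c \<tau> * ?E \<tau>)) \<partial>lborel) * (\<integral>\<^sup>+t. ennreal (norm (power_kernel e t * ?E t)) \<partial>lborel)"
    by (rule nn_integral_cmult) measurable
  also have "\<dots> < \<infinity>"
    using Gc Ge by (auto simp: integrable_iff_bounded ennreal_mult_less_top)
  finally have int: "integrable (lborel \<Otimes>\<^sub>M lborel) (case_prod P)"
    by (intro integrableI_bounded) auto
  have 1: "(LINT t|lborel. P t \<tau>) = convolution (power_kernel c) (power_kernel e) \<tau> * ?E \<tau>" for \<tau>
  proof -
    have "P t \<tau> = (power_kernel c (\<tau> - t) * power_kernel e t) * ?E \<tau>" for t
      by (simp add: P_def exp_diff exp_minus field_simps flip: of_real_mult)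
    then show ?thesis by (simp add: convolution_def)
  qed
  have 2: "(LINT \<tau>|lborel. P t \<tau>) = Gamma c * (power_kernel e t * ?E t)" for t
    unfolding P_def using integral_shift[of "\<lambda>\<tau>. power_kernel c \<tau> * ?E \<tau>" t] Gc by simp
  have "(LINT \<tau>|lborel. convolution (power_kernel c) (power_kernel e) \<tau> * ?E \<tau>) = Gamma c * Gamma e"
    using lborel_pair.Fubini_integral[OF int] Ge unfolding 1 2 by simp
  also have "(\<lambda>\<tau>. convolution (power_kernel c) (power_kernel e) \<tau> * ?E \<tau>) = (\<lambda>\<tau>. convolution (power_kernel c) (power_kernel e) 1 * (power_kernel (c + e) \<tau> * ?E \<tau>))"
  proof
    fix \<tau> show "convolution (power_kernel c) (power_kernel e) \<tau> * ?E \<tau> = convolution (power_kernel c) (power_kernel e) 1 * (power_kernel (c + e) \<tau> * ?E \<tau>)"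
      using convolution_power_kernel_scale[of \<tau> c e] convolution_power_kernel_nonpos[of \<tau> c e] by (cases "\<tau> > 0") auto
  qed
  also have "(LINT \<tau>|lborel. convolution (power_kernel c) (power_kernel e) 1 * (power_kernel (c + e) \<tau> * ?E \<tau>)) = convolution (power_kernel c) (power_kernel e) 1 * Gamma (c + e)"
    using has_bochner_integral_power_kernel_exp[of "c + e"] c e by (simp add: has_bochner_integral_iff)
  finally have "convolution (power_kernel c) (power_kernel e) 1 * Gamma (c + e) = Gamma c * Gamma e" .
  moreover have "Gamma (c + e) \<noteq> 0"
    by (rule Gamma_nonzero) (use c e in simp)
  ultimately have "convolution (power_kernel c) (power_kernel e) 1 = Beta c e"
    by (simp add: Beta_def field_simps)
  then show ?thesis
    using convolution_power_kernel_scale[of s c e] convolution_power_kernel_nonpos[of s c e] by (cases "s > 0") auto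
qed

section \<open>Absolute values and bounds for the Beta integral\<close>

lemma norm_power_kernel_eq_Re: "norm (power_kernel c s) = Re (power_kernel (of_real (Re c)) s)"
  by (simp add: norm_power_kernel power_kernel_def powr_def Re_exp)

lemma Im_power_kernel_of_real: "Im (power_kernel (of_real y) s) = 0"
  by (simp add: power_kernel_def Im_exp)

text \<open>For y \<ge> 1 monotonicity gives the value 1 / p at y = 1 as a bound. For y < 1 one step
  of the recurrence raises y to y + 1 and leaves the pole 1 / y.\<close>

lemma Beta_real_bound:
  fixes p y :: real
  assumes p: "p > 0" and y: "y > 0"
  shows "Beta p y \<le> (1 + p) / p * (1 + 1 / y)"
proof -
  have "Gamma p \<noteq> 0"
    using Gamma_real_pos[OF p] by linarith
  then have one: "Beta p 1 = 1 / p"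
    using p Gamma_plus1[of p] by (simp add: Beta_def field_simps nonpos_Ints_def)
  show ?thesis
  proof (cases "y \<ge> 1")
    case True
    have "Beta p y \<le> 1 / p * 1"
      using Beta_real_mono[of p p 1 y] p True by (simp add: one)
    also have "\<dots> \<le> (1 + p) / p * (1 + 1 / y)"
      using p y by (intro mult_mono) (auto simp: field_simps)
    finally show ?thesis .
  next
    case False
    have "Beta p y = (p + y) / y * Beta p (y + 1)"
      using Beta_plus1_right[of y p] y by (auto simp: field_simps nonpos_Ints_def)
    also have "\<dots> \<le> (p + 1) / y * (1 / p)"
    proof (intro mult_mono divide_right_mono)
      show "Beta p (y + 1) \<le> 1 / p"
        using Beta_real_mono[of p p 1 "y + 1"] p y by (simp add: one)
      show "0 \<le> Beta p (y + 1)"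
        using p y by (auto simp: Beta_def intro!: divide_nonneg_pos mult_nonneg_nonneg Gamma_real_nonneg)
    qed (use p y False in auto)
    also have "\<dots> \<le> (1 + p) / p * (1 + 1 / y)"
      using p y by (simp add: field_simps)
    finally show ?thesis .
  qed
qed

text \<open>The norm of a power kernel is the kernel of the real part of its exponent, so this is
  the Beta integral for Re c and Re e.\<close>

lemma nn_convolution_power_kernel:
  assumes c: "Re c > 0" and e: "Re e > 0"
  shows "(\<integral>\<^sup>+u. ennreal (norm (power_kernel c (s - u) * power_kernel e u)) \<partial>lborel) = ennreal (Beta (Re c) (Re e) * norm (power_kernel (c + e) s))"
proof -
  let ?c = "complex_of_real (Re c)" and ?e = "complex_of_real (Re e)"
  have eq: "complex_of_real (norm (power_kernel c (s - u) * power_kernel e u)) = power_kernel ?c (s - u) * power_kernel ?e u" for u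
    by (auto simp: complex_eq_iff norm_mult norm_power_kernel_eq_Re Im_power_kernel_of_real)
  have val: "convolution (power_kernel ?c) (power_kernel ?e) s = complex_of_real (Beta (Re c) (Re e) * norm (power_kernel (c + e) s))"
  proof -
    have "power_kernel (?c + ?e) s = complex_of_real (norm (power_kernel (c + e) s))"
      using norm_power_kernel_eq_Re[of "c + e" s] Im_power_kernel_of_real[of "Re c + Re e" s] by (auto simp: complex_eq_iff)
    moreover have "convolution (power_kernel ?c) (power_kernel ?e) s = Beta ?c ?e * power_kernel (?c + ?e) s"
      using c e by (intro convolution_power_kernel) auto
    ultimately show ?thesis by (simp add: Beta_complex_of_real)
  qed
  show ?thesis
  proof (cases "s > 0")
    case True
    \<comment> \<open>The Bochner integral of a non-integrable function is 0 by default, so a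
      nonzero value already proves integrability.\<close>
    have "convolution (power_kernel ?c) (power_kernel ?e) s \<noteq> 0"
      unfolding val using True c e by (simp add: norm_power_kernel Beta_def)
         (metis Gamma_real_pos add_pos_pos less_irrefl)
    then have "integrable lborel (\<lambda>u. power_kernel ?c (s - u) * power_kernel ?e u)"
      using not_integrable_integral_eq by (force simp: convolution_def)
    then have int: "integrable lborel (\<lambda>u. norm (power_kernel c (s - u) * power_kernel e u))"
      unfolding eq[symmetric] by (rule complex_of_real_integrable_eq[THEN iffD1])
    have "complex_of_real (LINT u|lborel. norm (power_kernel c (s - u) * power_kernel e u)) = convolution (power_kernel ?c) (power_kernel ?e) s"
      by (simp add: convolution_def flip: eq)
    then have "(LINT u|lborel. norm (power_kernel c (s - u) * power_kernel e u)) = Beta (Re c) (Re e) * norm (power_kernel (c + e) s)"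
      unfolding val of_real_eq_iff .
    with nn_integral_eq_integral[OF int] show ?thesis by simp
  next
    case False
    then have "(\<lambda>u. ennreal (norm (power_kernel c (s - u) * power_kernel e u))) = (\<lambda>u. 0)"
      by (auto simp: power_kernel_def fun_eq_iff)
    then show ?thesis using False by simp
  qed
qed

text \<open>The triangle inequality for the Beta integral at s = 1.\<close>

lemma norm_Beta_le:
  assumes "Re c > 0" "Re e > 0"
  shows "norm (Beta c e) \<le> Beta (Re c) (Re e)"
proof -
  have "ennreal (norm (Beta c e)) = ennreal (norm (convolution (power_kernel c) (power_kernel e) 1))"
    using convolution_power_kernel[OF assms, of 1] by (simp add: power_kernel_def)
  also have "\<dots> \<le> (\<integral>\<^sup>+u. ennreal (norm (power_kernel c (1 - u) * power_kernel e u)) \<partial>lborel)"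
    unfolding convolution_def
    using integral_norm_bound_ennreal[of lborel "\<lambda>u. power_kernel c (1 - u) * power_kernel e u"]
      not_integrable_integral_eq[of lborel "\<lambda>u. power_kernel c (1 - u) * power_kernel e u"]
    by (cases "integrable lborel (\<lambda>u. power_kernel c (1 - u) * power_kernel e u)") auto
  also have "\<dots> = ennreal (Beta (Re c) (Re e))"
    using nn_convolution_power_kernel[OF assms, of 1] by (simp add: norm_power_kernel)
  finally show ?thesis
    using assms by (subst (asm) ennreal_le_iff)
      (auto simp: Beta_def intro!: divide_nonneg_pos mult_nonneg_nonneg Gamma_real_nonneg)
qed

text \<open>For fixed c with Re c > 0, the factor 1 + 1 / Re (e \<sigma>) dominates Beta c (e
  \<sigma>) up to a constant (\<open>Beta_real_bound\<close>), so finiteness survives convolution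
  with a power kernel. The power of S is S times the norm of the kernel at S.\<close>

definition mixture_weight :: "(real \<Rightarrow> complex) \<Rightarrow> (real \<Rightarrow> complex) \<Rightarrow> real \<Rightarrow> ennreal" where
  "mixture_weight G e S = (\<integral>\<^sup>+\<sigma>. ennreal (norm (G \<sigma>) * (1 + 1 / Re (e \<sigma>)) * S powr Re (e \<sigma>)) \<partial>lborel)"

section \<open>Iterated derivatives of iterated integrals\<close>

text \<open>\<open>power_kernel 1\<close> is the Heaviside function, so convolution with it is the
  primitive from minus infinity; the hypothesis means integrability on every left half-line.\<close>

lemma set_integrable_if_power_kernel_one:
  fixes f :: "real \<Rightarrow> complex"
  assumes int: "\<And>x. integrable lborel (\<lambda>\<tau>. power_kernel 1 (x - \<tau>) * f \<tau>)"
  shows "set_integrable lborel {..<x} f"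
proof -
  have "power_kernel 1 (x - \<tau>) * f \<tau> = indicator {..<x} \<tau> *\<^sub>R f \<tau>" for \<tau>
    by (simp add: power_kernel_one indicator_def)
  then show ?thesis using int[of x] by (simp add: set_integrable_def)
qed

lemma convolution_power_kernel_one_eq: "convolution (power_kernel 1) f x = (LINT t:{..<x}|lborel. f t)"
  unfolding convolution_def set_lebesgue_integral_def
  by (intro Bochner_Integration.integral_cong refl) (simp add: power_kernel_one indicator_def)

lemma integrable_on_if_power_kernel_one:
  fixes f :: "real \<Rightarrow> complex"
  assumes int: "\<And>x. integrable lborel (\<lambda>\<tau>. power_kernel 1 (x - \<tau>) * f \<tau>)"
  shows "f integrable_on {c..y}"
proof -
  have "set_integrable lborel {c..y} f"
    by (rule set_integrable_subset[OF set_integrable_if_power_kernel_one[OF int, of "y + 1"]]) auto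
  then show ?thesis by (rule set_borel_integral_eq_integral)
qed

lemma convolution_power_kernel_one_split:
  fixes f :: "real \<Rightarrow> complex"
  assumes int: "\<And>x. integrable lborel (\<lambda>\<tau>. power_kernel 1 (x - \<tau>) * f \<tau>)"
    and "c \<le> y"
  shows "convolution (power_kernel 1) f y = convolution (power_kernel 1) f c + integral {c..y} f"
proof -
  have si: "set_integrable lborel {c..<y} f"
    by (rule set_integrable_subset[OF set_integrable_if_power_kernel_one[OF int, of y]]) auto
  have "(LINT t:{..<c} \<union> {c..<y}|lborel. f t) = (LINT t:{..<c}|lborel. f t) + (LINT t:{c..<y}|lborel. f t)"
    by (rule set_integral_Un[OF _ set_integrable_if_power_kernel_one[OF int] si]) auto
  moreover have "{..<c} \<union> {c..<y} = {..<y}" using assms by auto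
  moreover have "(LINT t:{c..<y}|lborel. f t) = integral {c..y} f"
  proof -
    have "integral {c..<y} f = integral {c..y} f"
      by (rule integral_spike_set) (auto intro: negligible_subset[of "{y}"])
    then show ?thesis using set_borel_integral_eq_integral(2)[OF si] by simp
  qed
  ultimately show ?thesis by (simp add: convolution_power_kernel_one_eq)
qed

lemma has_vector_derivative_convolution_power_kernel_one:
  fixes f :: "real \<Rightarrow> complex"
  assumes int: "\<And>x. integrable lborel (\<lambda>\<tau>. power_kernel 1 (x - \<tau>) * f \<tau>)"
    and "c < x" and der: "((\<lambda>y. integral {c..y} f) has_vector_derivative D) (at x)"
  shows "vderiv (convolution (power_kernel 1) f) x = D"
proof -
  have "((\<lambda>y. convolution (power_kernel 1) f c + integral {c..y} f) has_vector_derivative D) (at x)"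
    using der by (auto intro!: derivative_eq_intros)
  then have "(convolution (power_kernel 1) f has_vector_derivative D) (at x)"
  proof (rule has_vector_derivative_transform_within_open[where S = "{c<..}"])
    show "convolution (power_kernel 1) f c + integral {c..y} f = convolution (power_kernel 1) f y" if "y \<in> {c<..}" for y
      using convolution_power_kernel_one_split[OF int, of c y] that by simp
  qed (use assms(2,3) in auto)
  then show ?thesis unfolding vderiv_def by (rule vector_derivative_at)
qed

lemma continuous_convolution_power_kernel_one:
  fixes f :: "real \<Rightarrow> complex"
  assumes int: "\<And>x. integrable lborel (\<lambda>\<tau>. power_kernel 1 (x - \<tau>) * f \<tau>)"
  shows "continuous_on UNIV (convolution (power_kernel 1) f)"
proof (rule continuous_at_imp_continuous_on, rule ballI)
  fix x :: real
  have "continuous_on {x - 1..x + 1} (\<lambda>y. convolution (power_kernel 1) f (x - 1) + integral {x - 1..y} f)"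
    by (intro continuous_intros indefinite_integral_continuous_1 integrable_on_if_power_kernel_one int)
  then have "continuous_on {x - 1..x + 1} (convolution (power_kernel 1) f)"
    by (rule continuous_on_eq) (simp add: convolution_power_kernel_one_split[OF int, of "x - 1", symmetric])
  then show "isCont (convolution (power_kernel 1) f) x"
    by (rule continuous_on_interior) (simp add: interior_atLeastAtMost_real)
qed

lemma vderiv_convolution_power_kernel_one:
  fixes f :: "real \<Rightarrow> complex"
  assumes int: "\<And>x. integrable lborel (\<lambda>\<tau>. power_kernel 1 (x - \<tau>) * f \<tau>)"
    and "continuous_on UNIV f"
  shows "vderiv (convolution (power_kernel 1) f) = f"
proof
  fix x
  have "((\<lambda>u. integral {x - 1..u} f) has_vector_derivative f x) (at x within {x - 1..x + 1})"
    using assms(2) by (intro integral_has_vector_derivative) (auto intro: continuous_on_subset)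
  then show "vderiv (convolution (power_kernel 1) f) x = f x"
    by (intro has_vector_derivative_convolution_power_kernel_one[OF int, of "x - 1"]) (auto simp: at_within_Icc_at)
qed

lemma AE_vderiv_convolution_power_kernel_one:
  fixes f :: "real \<Rightarrow> complex"
  assumes int: "\<And>x. integrable lborel (\<lambda>\<tau>. power_kernel 1 (x - \<tau>) * f \<tau>)"
  shows "AE x in lborel. vderiv (convolution (power_kernel 1) f) x = f x"
proof -
  \<comment> \<open>The differentiation theorem lives on a compact interval; countably many of them
    exhaust the line.\<close>
  have "AE x in lborel. \<forall>n. - real n < x \<and> x < real n \<longrightarrow>
      ((\<lambda>y. integral {- real n..y} f) has_vector_derivative f x) (at x)"
    unfolding AE_all_countable by (intro allI AE_integral_has_vector_derivative integrable_on_if_power_kernel_one int)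
  then show ?thesis
  proof eventually_elim
    case (elim x)
    obtain n where n: "\<bar>x\<bar> < real n" using reals_Archimedean2 by blast
    then have "- real n < x" "x < real n" by linarith+
    then show ?case
      using elim by (intro has_vector_derivative_convolution_power_kernel_one[OF int, of "- real n"]) auto
  qed
qed

text \<open>Each \<open>J (Suc k)\<close> is continuous, so the first r - 1 derivatives undo the
  primitives at every point. This matters: an identity holding only almost everywhere could not be
  differentiated again. The step from \<open>J 1\<close> to \<open>J 0\<close> alone uses Lebesgue
  differentiation.\<close>

lemma AE_funpow_vderiv_convolution_power_kernel_one:
  fixes J :: "nat \<Rightarrow> real \<Rightarrow> complex"
  assumes Suc: "\<And>k. J (Suc k) = convolution (power_kernel 1) (J k)"
    and int: "\<And>k x. integrable lborel (\<lambda>\<tau>. power_kernel 1 (x - \<tau>) * J k \<tau>)" and r: "r \<ge> 1"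
  shows "AE x in lborel. (vderiv ^^ r) (J r) x = J 0 x"
proof -
  have "vderiv (J (Suc (Suc k))) = J (Suc k)" for k
    using continuous_convolution_power_kernel_one[OF int, of k] vderiv_convolution_power_kernel_one[OF int, of "Suc k"] by (simp add: Suc)
  then have *: "(vderiv ^^ k) (J (Suc k)) = J 1" for k
    by (induction k) (simp_all add: funpow_Suc_right del: funpow.simps)
  obtain k where k: "r = Suc k" using r by (cases r) auto
  show ?thesis
    using AE_vderiv_convolution_power_kernel_one[OF int, of 0] * by (simp add: k Suc[symmetric])
qed

section \<open>The H-function operators as convolutions\<close>

lemma fox_left_polesI:
  "j < n \<Longrightarrow> 1 - fst (A ! j) + of_real (snd (A ! j)) * \<xi> = - of_nat k \<Longrightarrow> \<xi> \<in> fox_left_poles n A"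
  unfolding fox_left_poles_def by blast

lemma fox_left_poles_append:
  "fox_left_poles n A \<subseteq> fox_left_poles (n + 2) ([p, q] @ A)"
proof
  fix \<xi> assume "\<xi> \<in> fox_left_poles n A"
  then obtain j k where "j < n" "1 - fst (A ! j) + of_real (snd (A ! j)) * \<xi> = - of_nat k"
    by (auto simp: fox_left_poles_def)
  then show "\<xi> \<in> fox_left_poles (n + 2) ([p, q] @ A)"
    unfolding fox_left_poles_def by (intro CollectI exI[of _ "j + 2"] conjI exI[of _ k]) auto
qed

lemma fox_right_poles_append:
  "m \<le> length B \<Longrightarrow> fox_right_poles m (B @ C) = fox_right_poles m B"
  unfolding fox_right_poles_def
  by (intro Collect_cong ex_cong1 conj_cong refl) (simp add: nth_append)

lemma separates_mono:
  assumes "P \<subseteq> P'" "Q \<subseteq> Q'"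
  shows "(separates_vertical L P' Q' \<longrightarrow> separates_vertical L P Q) \<and>
    (separates_right_loop L P' Q' \<longrightarrow> separates_right_loop L P Q) \<and>
    (separates_left_loop L P' Q' \<longrightarrow> separates_left_loop L P Q)"
  unfolding separates_vertical_def separates_right_loop_def separates_left_loop_def
  using subsetD[OF assms(1)] subsetD[OF assms(2)] by simp

lemma fox_contour_mono:
  assumes "fox_contour m' n' A' B' L"
    and sub: "fox_left_poles n A \<subseteq> fox_left_poles n' A'" "fox_right_poles m B \<subseteq> fox_right_poles m' B'"
  shows "fox_contour m n A B L"
  using assms(1) separates_mono[OF sub, of L] unfolding fox_contour_def by metis

lemma separates_avoids:
  assumes "separates_vertical L P Q \<or> separates_right_loop L P Q \<or> separates_left_loop L P Q"
  shows "L \<sigma> \<notin> P"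
proof
  assume "L \<sigma> \<in> P"
  then obtain \<theta> where "turns_around L (L \<sigma>) \<theta>"
    using assms unfolding separates_vertical_def separates_right_loop_def separates_left_loop_def by metis
  then show False by (simp add: turns_around_def)
qed

lemma fox_contour_avoids_left_poles:
  assumes "fox_contour m n A B L"
  shows "L \<sigma> \<notin> fox_left_poles n A"
  by (rule separates_avoids[where Q = "fox_right_poles m B"]) (use assms in \<open>simp add: fox_contour_def\<close>)

lemma fox_contour_continuous:
  assumes "fox_contour m n A B L"
  shows "continuous_on UNIV L"
proof (rule continuous_at_imp_continuous_on, rule ballI)
  fix \<sigma> :: real
  have "0 < \<bar>\<sigma>\<bar> + 1" by linarith
  then have "L piecewise_C1_differentiable_on {- (\<bar>\<sigma>\<bar> + 1)..\<bar>\<sigma>\<bar> + 1}"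
    using assms unfolding fox_contour_def by blast
  then have "continuous_on {- (\<bar>\<sigma>\<bar> + 1)..\<bar>\<sigma>\<bar> + 1} L"
    unfolding piecewise_C1_differentiable_on_def by blast
  then show "isCont L \<sigma>"
    by (rule continuous_on_interior) (auto simp: interior_atLeastAtMost_real)
qed

text \<open>The common factor with c2 is left uncancelled: at its poles \<open>Gamma\<close> is 0 by
  default and the quotient is 0, not 1. It is cancelled later, on a contour that avoids these
  poles.\<close>

lemma fox_phi_append:
  assumes "m \<le> length B"
  shows "fox_phi m (n + 2) ([(1 - c1, \<alpha>), (1 - c2, \<alpha>)] @ A) (B @ [(1 - c2, \<alpha>), (1 - c3, \<alpha>)]) \<xi>
    = fox_phi m n A B \<xi> * (Gamma (c1 + of_real \<alpha> * \<xi>) * Gamma (c2 + of_real \<alpha> * \<xi>)) /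
      (Gamma (c2 + of_real \<alpha> * \<xi>) * Gamma (c3 + of_real \<alpha> * \<xi>))"
proof -
  let ?A = "[(1 - c1, \<alpha>), (1 - c2, \<alpha>)] @ A" and ?B = "B @ [(1 - c2, \<alpha>), (1 - c3, \<alpha>)]"
  have 1: "(\<Prod>j<m. Gamma (fst (?B ! j) - of_real (snd (?B ! j)) * \<xi>))
      = (\<Prod>j<m. Gamma (fst (B ! j) - of_real (snd (B ! j)) * \<xi>))"
    using assms by (intro prod.cong refl) (simp add: nth_append)
  have 2: "(\<Prod>j<n+2. Gamma (1 - fst (?A ! j) + of_real (snd (?A ! j)) * \<xi>))
      = Gamma (c1 + of_real \<alpha> * \<xi>) * Gamma (c2 + of_real \<alpha> * \<xi>) * (\<Prod>j<n. Gamma (1 - fst (A ! j) + of_real (snd (A ! j)) * \<xi>))"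
    by (simp add: prod.lessThan_Suc_shift del: prod.lessThan_Suc)
  have 3: "(\<Prod>j=n+2..<length ?A. Gamma (fst (?A ! j) - of_real (snd (?A ! j)) * \<xi>))
      = (\<Prod>j=n..<length A. Gamma (fst (A ! j) - of_real (snd (A ! j)) * \<xi>))"
  proof -
    have "length ?A = length A + 2" by simp
    then show ?thesis by (simp only: prod.shift_bounds_nat_ivl) simp
  qed
  have 4: "(\<Prod>j=m..<length ?B. Gamma (1 - fst (?B ! j) + of_real (snd (?B ! j)) * \<xi>))
      = (\<Prod>j=m..<length B. Gamma (1 - fst (B ! j) + of_real (snd (B ! j)) * \<xi>)) *
        (Gamma (c2 + of_real \<alpha> * \<xi>) * Gamma (c3 + of_real \<alpha> * \<xi>))"
  proof -
    have "(\<Prod>j=m..<length B. Gamma (1 - fst (?B ! j) + of_real (snd (?B ! j)) * \<xi>))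
      = (\<Prod>j=m..<length B. Gamma (1 - fst (B ! j) + of_real (snd (B ! j)) * \<xi>))"
      by (intro prod.cong refl) (simp add: nth_append)
    then show ?thesis
      using assms by (simp add: prod.atLeastLessThan_Suc nth_append mult.assoc)
  qed
  show ?thesis
    unfolding fox_phi_def 1 2 3 4 by (simp add: mult_ac)
qed

text \<open>The factor s powr \<alpha> is a positive real, so it splits off the principal power
  without a change of branch. The dependence on s becomes a pure power, which makes the kernel of
  the operator a power mixture.\<close>

lemma fox_integrand_scale:
  assumes "s > 0" "w \<noteq> 0"
  shows "fox_integrand m n A B L (w * of_real (s powr \<alpha>)) \<sigma>
    = fox_integrand m n A B L w \<sigma> * of_real s powr (of_real \<alpha> * L \<sigma>)"
proof -
  have "(w * of_real (s powr \<alpha>)) powr L \<sigma> = of_real (s powr \<alpha>) powr L \<sigma> * w powr L \<sigma>"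
    by (subst mult.commute, rule powr_times_real_left) auto
  also have "of_real (s powr \<alpha>) powr L \<sigma> = complex_of_real s powr (of_real \<alpha> * L \<sigma>)"
    using assms by (simp add: powr_def Ln_of_real ln_powr mult_ac)
  finally show ?thesis by (simp add: fox_integrand_def mult_ac)
qed

text \<open>The weight of the power mixture: the contour integrand at s = 1, with the normalization
  of the H-function included.\<close>

definition fox_density ::
  "nat \<Rightarrow> nat \<Rightarrow> (complex \<times> real) list \<Rightarrow> (complex \<times> real) list \<Rightarrow> (real \<Rightarrow> complex) \<Rightarrow>
   complex \<Rightarrow> real \<Rightarrow> complex" where
  "fox_density m n A B L w \<sigma> = fox_integrand m n A B L w \<sigma> / (2 * of_real pi * \<i>)"

text \<open>Definedness includes independence of the contour, so every contour with absolute
  convergence may serve.\<close>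

lemma fox_H_eq:
  assumes "fox_contour m n A B L" "fox_H_defined m n A B z" "integrable lborel (fox_integrand m n A B L z)"
  shows "fox_H m n A B z = 1 / (2 * of_real pi * \<i>) * (LINT \<sigma>|lborel. fox_integrand m n A B L z \<sigma>)"
  unfolding fox_H_def
proof (rule the1_equality)
  show "\<exists>!h. has_fox_H m n A B z h"
    using assms(2) unfolding fox_H_defined_def by blast
  show "has_fox_H m n A B z (1 / (2 * of_real pi * \<i>) * (LINT \<sigma>|lborel. fox_integrand m n A B L z \<sigma>))"
    unfolding has_fox_H_def using assms(1,3) by blast
qed

lemma fox_op_eq_convolution:
  assumes L: "fox_contour m n A B L" and def: "\<And>s. s > 0 \<Longrightarrow> fox_H_defined m n A B (w * of_real (s powr \<alpha>))"
    and int: "\<And>s. s > 0 \<Longrightarrow> integrable lborel (fox_integrand m n A B L (w * of_real (s powr \<alpha>)))"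
    and w: "w \<noteq> 0"
  shows "fox_op a w m n \<alpha> \<beta> A B \<phi> =
    convolution (power_mixture (fox_density m n A B L w) (\<lambda>\<sigma>. \<beta> + of_real \<alpha> * L \<sigma>)) (\<lambda>t. if a < t then \<phi> t else 0)"
proof
  fix x
  have ker: "of_real s powr (\<beta> - 1) * fox_H m n A B (w * of_real (s powr \<alpha>))
      = power_mixture (fox_density m n A B L w) (\<lambda>\<sigma>. \<beta> + of_real \<alpha> * L \<sigma>) s" if s: "s > 0" for s
  proof -
    have "power_mixture (fox_density m n A B L w) (\<lambda>\<sigma>. \<beta> + of_real \<alpha> * L \<sigma>) s
      = (LINT \<sigma>|lborel. of_real s powr (\<beta> - 1) / (2 * of_real pi * \<i>) * fox_integrand m n A B L (w * of_real (s powr \<alpha>)) \<sigma>)"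
      unfolding power_mixture_def fox_density_def power_kernel_add[OF s] fox_integrand_scale[OF s w]
      by (intro Bochner_Integration.integral_cong refl) (simp add: power_kernel_eq_powr[OF s])
    also have "\<dots> = of_real s powr (\<beta> - 1) * (1 / (2 * of_real pi * \<i>) * (LINT \<sigma>|lborel. fox_integrand m n A B L (w * of_real (s powr \<alpha>)) \<sigma>))"
      by (subst integral_mult_right_zero) simp
    finally show ?thesis by (simp only: fox_H_eq[OF L def[OF s] int[OF s]])
  qed
  show "fox_op a w m n \<alpha> \<beta> A B \<phi> x =
    convolution (power_mixture (fox_density m n A B L w) (\<lambda>\<sigma>. \<beta> + of_real \<alpha> * L \<sigma>)) (\<lambda>t. if a < t then \<phi> t else 0) x"
    unfolding fox_op_def convolution_def set_lebesgue_integral_def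
  proof (intro Bochner_Integration.integral_cong refl)
    fix t
    show "indicat_real {a<..<x} t *\<^sub>R (of_real (x - t) powr (\<beta> - 1) *
        fox_H m n A B (w * of_real ((x - t) powr \<alpha>)) * \<phi> t)
      = power_mixture (fox_density m n A B L w) (\<lambda>\<sigma>. \<beta> + of_real \<alpha> * L \<sigma>) (x - t) * (if a < t then \<phi> t else 0)"
      using ker[of "x - t"] by (cases "t < x") (auto simp: indicator_def)
  qed
qed

lemma rl_integral_eq_convolution:
  assumes "\<And>t. t \<le> a \<Longrightarrow> f t = 0"
  shows "rl_integral c a f x = 1 / Gamma c * convolution (power_kernel c) f x"
proof -
  have "indicat_real {a<..<x} t *\<^sub>R (f t / of_real (x - t) powr (1 - c)) = power_kernel c (x - t) * f t" for t
  proof (cases "a < t \<and> t < x")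
    case True
    have "complex_of_real (x - t) powr (c - 1) = inverse (of_real (x - t) powr (1 - c))"
      by (metis minus_diff_eq powr_minus)
    then show ?thesis using True by (simp add: power_kernel_eq_powr divide_inverse mult.commute)
  qed (use assms in \<open>auto simp: indicator_def not_less\<close>)
  then show ?thesis by (simp add: rl_integral_def convolution_def set_lebesgue_integral_def)
qed

lemma norm_fox_integrand_scale:
  assumes "s > 0" "w \<noteq> 0"
  shows "norm (of_real s powr (\<beta> - 1)) * norm (fox_integrand m n A B L (w * of_real (s powr \<alpha>)) \<sigma>)
    = 2 * pi * norm (fox_density m n A B L w \<sigma>) * s powr (Re (\<beta> + of_real \<alpha> * L \<sigma>) - 1)"
proof -
  have "power_kernel (\<beta> + of_real \<alpha> * L \<sigma>) s = of_real s powr (\<beta> - 1) * of_real s powr (of_real \<alpha> * L \<sigma>)"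
    using assms power_kernel_add[of s \<beta>] by (simp add: power_kernel_eq_powr[of s \<beta>])
  then have "norm (of_real s powr (\<beta> - 1)) * norm (fox_integrand m n A B L (w * of_real (s powr \<alpha>)) \<sigma>)
     = norm (power_kernel (\<beta> + of_real \<alpha> * L \<sigma>) s * fox_integrand m n A B L w \<sigma>)"
    using assms by (simp add: fox_integrand_scale norm_mult)
  then show ?thesis using assms by (simp add: norm_mult norm_power_kernel fox_density_def norm_divide)
qed

text \<open>Keep only x - \<delta> < t < x, substitute u = x - t, and drop the factor 2 * pi, which
  is at least 1. This isolates the behaviour of the kernel at its singularity u = 0.\<close>

lemma fox_op_abs_ge:
  assumes w: "w \<noteq> 0" and \<delta>: "\<delta> \<le> x - a"
    and [measurable]: "fox_density m n A B L w \<in> borel_measurable borel" "L \<in> borel_measurable borel"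
      "(\<lambda>t. if a < t then \<phi> t else 0) \<in> borel_measurable borel"
  shows "(\<integral>\<^sup>+u\<in>{0<..<\<delta>}. ennreal (norm (if a < x - u then \<phi> (x - u) else 0)) *
      (\<integral>\<^sup>+\<sigma>. ennreal (norm (fox_density m n A B L w \<sigma>) * u powr (Re (\<beta> + of_real \<alpha> * L \<sigma>) - 1)) \<partial>lborel) \<partial>lborel)
    \<le> fox_op_abs a w m n \<alpha> \<beta> A B L \<phi> x"
proof -
  let ?K = "\<lambda>u. \<integral>\<^sup>+\<sigma>. ennreal (norm (fox_density m n A B L w \<sigma>) * u powr (Re (\<beta> + of_real \<alpha> * L \<sigma>) - 1)) \<partial>lborel"
  let ?F = "\<lambda>t. ennreal (norm (if a < t then \<phi> t else 0)) * ?K (x - t) * indicator {0<..<\<delta>} (x - t)"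
  have "(\<integral>\<^sup>+u. ?F (x - u) \<partial>lborel) = (\<integral>\<^sup>+t. ?F t \<partial>lborel)"
    by (rule nn_integral_reflect) measurable
  also have "\<dots> \<le> fox_op_abs a w m n \<alpha> \<beta> A B L \<phi> x"
    unfolding fox_op_abs_def
  proof (rule nn_integral_mono)
    fix t
    let ?I = "\<integral>\<^sup>+\<sigma>. ennreal (norm (fox_integrand m n A B L (w * of_real ((x - t) powr \<alpha>)) \<sigma>)) \<partial>lborel"
    have "?K (x - t) \<le> ennreal (norm (complex_of_real (x - t) powr (\<beta> - 1))) * ?I" if "t < x"
    proof -
      have meas: "(\<lambda>\<sigma>. norm (fox_integrand m n A B L (w * of_real ((x - t) powr \<alpha>)) \<sigma>)) \<in> borel_measurable lborel"
      proof -
        have "(\<lambda>\<sigma>. norm (fox_integrand m n A B L (w * of_real ((x - t) powr \<alpha>)) \<sigma>))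
          = (\<lambda>\<sigma>. 2 * pi * norm (fox_density m n A B L w \<sigma>) * (x - t) powr (Re (\<beta> + of_real \<alpha> * L \<sigma>) - 1)
              / norm (complex_of_real (x - t) powr (\<beta> - 1)))"
          using norm_fox_integrand_scale[of "x - t" w \<beta> m n A B L \<alpha>] that w
          by (intro ext) (simp add: field_simps)
        then show ?thesis by simp
      qed
      have "?K (x - t) \<le> (\<integral>\<^sup>+\<sigma>. ennreal (norm (complex_of_real (x - t) powr (\<beta> - 1))) *
          ennreal (norm (fox_integrand m n A B L (w * of_real ((x - t) powr \<alpha>)) \<sigma>)) \<partial>lborel)"
      proof (rule nn_integral_mono)
        fix \<sigma>
        have "norm (fox_density m n A B L w \<sigma>) * (x - t) powr (Re (\<beta> + of_real \<alpha> * L \<sigma>) - 1)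
          \<le> 2 * pi * (norm (fox_density m n A B L w \<sigma>) * (x - t) powr (Re (\<beta> + of_real \<alpha> * L \<sigma>) - 1))"
          using pi_ge_two by (intro mult_right_mono[of 1 "2 * pi", simplified]) auto
        then show "ennreal (norm (fox_density m n A B L w \<sigma>) * (x - t) powr (Re (\<beta> + of_real \<alpha> * L \<sigma>) - 1))
          \<le> ennreal (norm (complex_of_real (x - t) powr (\<beta> - 1))) *
          ennreal (norm (fox_integrand m n A B L (w * of_real ((x - t) powr \<alpha>)) \<sigma>))"
          using norm_fox_integrand_scale[of "x - t" w \<beta> m n A B L \<alpha> \<sigma>] that w
          by (subst ennreal_mult[symmetric]) (auto intro!: ennreal_leI simp: mult.assoc)
      qed
      also have "\<dots> = ennreal (norm (complex_of_real (x - t) powr (\<beta> - 1))) * ?I"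
        by (intro nn_integral_cmult measurable_compose[OF meas measurable_ennreal])
      finally show ?thesis .
    qed
    then have "ennreal (norm (\<phi> t)) * ?K (x - t) \<le> ennreal (norm (\<phi> t)) * (ennreal (norm (complex_of_real (x - t) powr (\<beta> - 1))) * ?I)"
      if "t < x" using that by (intro mult_left_mono) auto
    then show "?F t \<le> ennreal (norm (of_real (x - t) powr (\<beta> - 1) * \<phi> t)) * ?I * indicator {a<..<x} t"
      using \<delta> by (auto simp: indicator_def norm_mult ennreal_mult mult_ac)
  qed
  finally show ?thesis by simp
qed

section \<open>Elementary properties of weights and power mixtures\<close>

lemma mixture_weight_scale:
  assumes [measurable]: "G \<in> borel_measurable borel" "e \<in> borel_measurable borel"
    and pos: "\<And>\<sigma>. G \<sigma> \<noteq> 0 \<Longrightarrow> Re (e \<sigma>) > 0"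
    and "mixture_weight G e S < \<infinity>"
  shows "mixture_weight (\<lambda>\<sigma>. k * G \<sigma>) e S < \<infinity>"
proof -
  have "mixture_weight (\<lambda>\<sigma>. k * G \<sigma>) e S = (\<integral>\<^sup>+\<sigma>. ennreal (norm k) * ennreal (norm (G \<sigma>) * (1 + 1 / Re (e \<sigma>)) * S powr Re (e \<sigma>)) \<partial>lborel)"
    unfolding mixture_weight_def
  proof (intro nn_integral_cong)
    fix \<sigma>
    show "ennreal (norm (k * G \<sigma>) * (1 + 1 / Re (e \<sigma>)) * S powr Re (e \<sigma>))
      = ennreal (norm k) * ennreal (norm (G \<sigma>) * (1 + 1 / Re (e \<sigma>)) * S powr Re (e \<sigma>))"
      by (simp add: norm_mult mult.assoc ennreal_mult')
  qed
  also have "\<dots> = ennreal (norm k) * mixture_weight G e S"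
    unfolding mixture_weight_def by (rule nn_integral_cmult) measurable
  finally show ?thesis using assms by (simp add: ennreal_mult_less_top)
qed

lemma power_mixture_AE_cong:
  assumes [measurable]: "G \<in> borel_measurable borel" "H \<in> borel_measurable borel" "e \<in> borel_measurable borel"
    and "AE \<sigma> in lborel. G \<sigma> = H \<sigma>"
  shows "power_mixture G e = power_mixture H e"
proof
  fix s
  have "AE \<sigma> in lborel. G \<sigma> * power_kernel (e \<sigma>) s = H \<sigma> * power_kernel (e \<sigma>) s"
    using assms(4) by eventually_elim simp
  then show "power_mixture G e s = power_mixture H e s"
    unfolding power_mixture_def by (intro integral_cong_AE) measurable
qed

lemma convolution_power_mixture_cmult: "convolution (power_mixture (\<lambda>\<sigma>. k * G \<sigma>) e) h x = k * convolution (power_mixture G e) h x"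
  by (simp add: convolution_def power_mixture_def mult.assoc)

lemma integrable_power_mixture:
  assumes [measurable]: "G \<in> borel_measurable borel" "e \<in> borel_measurable borel"
    and pos: "\<And>\<sigma>. G \<sigma> \<noteq> 0 \<Longrightarrow> Re (e \<sigma>) > 0" and S: "S > 0"
    and "mixture_weight G e S < \<infinity>"
  shows "integrable lborel (\<lambda>\<sigma>. G \<sigma> * power_kernel (e \<sigma>) S)"
proof (rule integrableI_bounded)
  have "(\<integral>\<^sup>+\<sigma>. ennreal (norm (G \<sigma> * power_kernel (e \<sigma>) S)) \<partial>lborel)
    \<le> (\<integral>\<^sup>+\<sigma>. ennreal (1 / S) * ennreal (norm (G \<sigma>) * (1 + 1 / Re (e \<sigma>)) * S powr Re (e \<sigma>)) \<partial>lborel)"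
  proof (rule nn_integral_mono)
    fix \<sigma>
    show "ennreal (norm (G \<sigma> * power_kernel (e \<sigma>) S)) \<le> ennreal (1 / S) * ennreal (norm (G \<sigma>) * (1 + 1 / Re (e \<sigma>)) * S powr Re (e \<sigma>))"
    proof (cases "G \<sigma> = 0")
      case False
      have "norm (G \<sigma>) * S powr Re (e \<sigma>) * 1 \<le> norm (G \<sigma>) * S powr Re (e \<sigma>) * (1 + 1 / Re (e \<sigma>))"
        using pos[OF False] by (intro mult_left_mono) auto
      then have "norm (G \<sigma> * power_kernel (e \<sigma>) S) \<le> 1 / S * (norm (G \<sigma>) * (1 + 1 / Re (e \<sigma>)) * S powr Re (e \<sigma>))"
        using S by (simp add: norm_mult norm_power_kernel powr_diff divide_right_mono mult_ac)
      then show ?thesis using S by (subst ennreal_mult'[symmetric]) (auto intro: ennreal_leI)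
    qed simp
  qed
  also have "\<dots> = ennreal (1 / S) * mixture_weight G e S"
    unfolding mixture_weight_def by (rule nn_integral_cmult) measurable
  also have "\<dots> < \<infinity>" using assms by (simp add: ennreal_mult_less_top)
  finally show "(\<integral>\<^sup>+\<sigma>. ennreal (norm (G \<sigma> * power_kernel (e \<sigma>) S)) \<partial>lborel) < \<infinity>" .
qed measurable

theorem theorem3:
  fixes a \<alpha> :: real and \<mu> \<beta> w :: complex and m n r :: nat
    and A B A' B' :: "(complex \<times> real) list" and \<phi> :: "real \<Rightarrow> complex"
  defines "r \<equiv> nat \<lfloor>Re \<mu>\<rfloor> + 1"
  defines "A' \<equiv> [(1 - \<beta>, \<alpha>), (1 - \<beta> - of_nat r + \<mu>, \<alpha>)] @ A"
  defines "B' \<equiv> B @ [(1 - \<beta> - of_nat r + \<mu>, \<alpha>), (1 - \<beta> + \<mu>, \<alpha>)]"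
  assumes "\<alpha> > 0" and "\<And>j. j < length A \<Longrightarrow> snd (A ! j) > 0" and "\<And>j. j < length B \<Longrightarrow> snd (B ! j) > 0"
    and "Re \<mu> > 0" and "Re \<beta> > 0" and "w \<noteq> 0"
    and "1 \<le> m" and "m \<le> length B" and "n \<le> length A"
    and "Re \<beta> + Min ((\<lambda>j. Re (of_real \<alpha> * fst (B ! j) / of_real (snd (B ! j)))) ` {..<m}) > 0"
    and "Re (\<beta> - \<mu>) > 0"
    and "Re (\<beta> - \<mu>) + Min ((\<lambda>j. Re (of_real \<alpha> * fst (B ! j) / of_real (snd (B ! j)))) ` {..<m}) > 0"
    and "\<And>s. s > 0 \<Longrightarrow> fox_H_defined m n A B (w * of_real (s powr \<alpha>))"
    and "\<And>s. s > 0 \<Longrightarrow> fox_H_defined m (n + 2) A' B' (w * of_real (s powr \<alpha>))"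
    and "\<And>c. c > a \<Longrightarrow> set_integrable lborel {a..c} \<phi>"
    and "\<exists>L. fox_contour m n A B L \<and>
           (\<forall>s>0. integrable lborel (fox_integrand m n A B L (w * of_real (s powr \<alpha>)))) \<and>
           (AE x in lborel. a < x \<longrightarrow>
              rl_integral_abs (of_nat r - \<mu>) a (fox_op_abs a w m n \<alpha> \<beta> A B L \<phi>) x < \<infinity>)"
    and "\<exists>L. fox_contour m (n + 2) A' B' L \<and>
           (\<forall>s>0. integrable lborel (fox_integrand m (n + 2) A' B' L (w * of_real (s powr \<alpha>)))) \<and>
           (AE x in lborel. a < x \<longrightarrow> fox_op_abs a w m (n + 2) \<alpha> (\<beta> - \<mu>) A' B' L \<phi> x < \<infinity>)"
    and "rl_derivative_exists \<mu> a (fox_op a w m n \<alpha> \<beta> A B \<phi>)"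
  shows "AE x in lborel. a < x \<longrightarrow>
           rl_derivative \<mu> a (fox_op a w m n \<alpha> \<beta> A B \<phi>) x =
           fox_op a w m (n + 2) \<alpha> (\<beta> - \<mu>) A' B' \<phi> x"
proof -

  \<comment> \<open>Convolution of power mixtures with power kernels\<close>
  have convolution_power_kernel_power_mixture: "convolution (power_kernel c) (power_mixture G e) s = power_mixture (\<lambda>\<sigma>. G \<sigma> * Beta c (e \<sigma>)) (\<lambda>\<sigma>. e \<sigma> + c) s \<and>
      (\<integral>\<^sup>+u. ennreal (norm (power_kernel c (s - u) * power_mixture G e u)) \<partial>lborel)
        \<le> ennreal ((1 + Re c) / Re c * s powr (Re c - 1)) * mixture_weight G e s"
    if [measurable]: "G \<in> borel_measurable borel" "e \<in> borel_measurable borel"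
      and pos: "\<And>\<sigma>. G \<sigma> \<noteq> 0 \<Longrightarrow> Re (e \<sigma>) > 0" and c: "Re c > 0"
      and fin: "mixture_weight G e s < \<infinity>" and s: "s > 0"
    for G e :: "real \<Rightarrow> complex" and c :: complex and s :: real
  proof (rule conjI)
    \<comment> \<open>Fubini in \<sigma> and u: the inner convolution contributes Beta c (e
      \<sigma>), which the factor 1 + 1 / Re (e \<sigma>) of the weight absorbs.\<close>
    define P where "P = (\<lambda>\<sigma> u. power_kernel c (s - u) * (G \<sigma> * power_kernel (e \<sigma>) u))"
    have [measurable]: "case_prod P \<in> borel_measurable (lborel \<Otimes>\<^sub>M lborel)"
      unfolding P_def by measurable
    let ?K = "(1 + Re c) / Re c * s powr (Re c - 1)"
    have "(\<integral>\<^sup>+\<sigma>. \<integral>\<^sup>+u. ennreal (norm (P \<sigma> u)) \<partial>lborel \<partial>lborel)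
       = (\<integral>\<^sup>+\<sigma>. ennreal (norm (G \<sigma>)) * (\<integral>\<^sup>+u. ennreal (norm (power_kernel c (s - u) * power_kernel (e \<sigma>) u)) \<partial>lborel) \<partial>lborel)"
      by (intro nn_integral_cong, subst nn_integral_cmult[symmetric])
        (auto simp: P_def norm_mult mult_ac simp flip: ennreal_mult)
    also have "\<dots> \<le> (\<integral>\<^sup>+\<sigma>. ennreal ?K * ennreal (norm (G \<sigma>) * (1 + 1 / Re (e \<sigma>)) * s powr Re (e \<sigma>)) \<partial>lborel)"
    proof (rule nn_integral_mono)
      fix \<sigma>
      show "ennreal (norm (G \<sigma>)) * (\<integral>\<^sup>+u. ennreal (norm (power_kernel c (s - u) * power_kernel (e \<sigma>) u)) \<partial>lborel)
        \<le> ennreal ?K * ennreal (norm (G \<sigma>) * (1 + 1 / Re (e \<sigma>)) * s powr Re (e \<sigma>))"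
      proof (cases "G \<sigma> = 0")
        case False
        then have e: "Re (e \<sigma>) > 0" by (rule pos)
        have sp: "s powr (Re c + Re (e \<sigma>) - 1) = s powr (Re c - 1) * s powr Re (e \<sigma>)"
          using s by (simp add: algebra_simps flip: powr_add)
        have "norm (G \<sigma>) * (Beta (Re c) (Re (e \<sigma>)) * norm (power_kernel (c + e \<sigma>) s))
           \<le> norm (G \<sigma>) * ((1 + Re c) / Re c * (1 + 1 / Re (e \<sigma>)) * norm (power_kernel (c + e \<sigma>) s))"
          by (intro mult_left_mono mult_right_mono Beta_real_bound c e) auto
        also have "\<dots> = ?K * (norm (G \<sigma>) * (1 + 1 / Re (e \<sigma>)) * s powr Re (e \<sigma>))"
          using s by (simp add: norm_power_kernel sp mult_ac)
        finally show ?thesis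
          unfolding nn_convolution_power_kernel[OF c e] using e c s
          by (simp add: ennreal_leI flip: ennreal_mult' ennreal_mult'')
      qed simp
    qed
    also have "\<dots> = ennreal ?K * mixture_weight G e s"
      unfolding mixture_weight_def by (rule nn_integral_cmult) measurable
    finally have bd: "(\<integral>\<^sup>+\<sigma>. \<integral>\<^sup>+u. ennreal (norm (P \<sigma> u)) \<partial>lborel \<partial>lborel) \<le> ennreal ?K * mixture_weight G e s" .
    also have "ennreal ?K * mixture_weight G e s < \<infinity>"
      using fin by (simp add: ennreal_mult_less_top)
    also have "(\<integral>\<^sup>+\<sigma>. \<integral>\<^sup>+u. ennreal (norm (P \<sigma> u)) \<partial>lborel \<partial>lborel)
      = (\<integral>\<^sup>+z. ennreal (norm (case_prod P z)) \<partial>(lborel \<Otimes>\<^sub>M lborel))"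
      by (subst lborel.nn_integral_fst[symmetric]) auto
    finally have int: "integrable (lborel \<Otimes>\<^sub>M lborel) (case_prod P)"
      by (intro integrableI_bounded) auto
    have 1: "(LINT \<sigma>|lborel. P \<sigma> u) = power_kernel c (s - u) * power_mixture G e u" for u
      by (simp add: P_def power_mixture_def)
    have 2: "(LINT u|lborel. P \<sigma> u) = G \<sigma> * Beta c (e \<sigma>) * power_kernel (e \<sigma> + c) s" for \<sigma>
    proof (cases "G \<sigma> = 0")
      case False
      have "(LINT u|lborel. P \<sigma> u) = G \<sigma> * convolution (power_kernel c) (power_kernel (e \<sigma>)) s"
        by (simp add: P_def convolution_def mult.left_commute flip: integral_mult_right_zero)
      then show ?thesis using convolution_power_kernel[OF c pos[OF False]] by (simp add: add.commute)
    qed (simp add: P_def)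
    show "convolution (power_kernel c) (power_mixture G e) s = power_mixture (\<lambda>\<sigma>. G \<sigma> * Beta c (e \<sigma>)) (\<lambda>\<sigma>. e \<sigma> + c) s"
      using lborel_pair.Fubini_integral[OF int] unfolding 1 2 by (simp add: convolution_def power_mixture_def)
    have "(\<integral>\<^sup>+u. ennreal (norm (power_kernel c (s - u) * power_mixture G e u)) \<partial>lborel)
       \<le> (\<integral>\<^sup>+u. \<integral>\<^sup>+\<sigma>. ennreal (norm (P \<sigma> u)) \<partial>lborel \<partial>lborel)"
      unfolding 1[symmetric]
    proof (rule nn_integral_mono)
      fix u
      \<comment> \<open>Fubini gives integrability in \<sigma> only for almost every u; in the
        remaining case the integral is 0 by default and the bound persists.\<close>
      show "ennreal (norm (LINT \<sigma>|lborel. P \<sigma> u)) \<le> (\<integral>\<^sup>+\<sigma>. ennreal (norm (P \<sigma> u)) \<partial>lborel)"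
        using integral_norm_bound_ennreal[of lborel "\<lambda>\<sigma>. P \<sigma> u"]
          not_integrable_integral_eq[of lborel "\<lambda>\<sigma>. P \<sigma> u"]
        by (cases "integrable lborel (\<lambda>\<sigma>. P \<sigma> u)") auto
    qed
    also have "\<dots> = (\<integral>\<^sup>+\<sigma>. \<integral>\<^sup>+u. ennreal (norm (P \<sigma> u)) \<partial>lborel \<partial>lborel)"
      by (rule lborel_pair.Fubini') measurable
    finally show "(\<integral>\<^sup>+u. ennreal (norm (power_kernel c (s - u) * power_mixture G e u)) \<partial>lborel)
        \<le> ennreal ((1 + Re c) / Re c * s powr (Re c - 1)) * mixture_weight G e s"
      using bd by (rule order_trans)
  qed

  \<comment> \<open>By \<open>ge1\<close> the total exponent Re e + Re c - 1 is nonnegative. The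
    absolute convolution of the kernels is then bounded on (0, S] by its estimate at S, so local
    integrability of h suffices for associativity.\<close>
  have convolution_power_kernel_convolution_power_mixture: "integrable lborel (\<lambda>\<tau>. power_kernel c (x - \<tau>) * convolution (power_mixture G e) h \<tau>) \<and>
      convolution (power_kernel c) (convolution (power_mixture G e) h) x = convolution (power_mixture (\<lambda>\<sigma>. G \<sigma> * Beta c (e \<sigma>)) (\<lambda>\<sigma>. e \<sigma> + c)) h x"
    if [measurable]: "G \<in> borel_measurable borel" "e \<in> borel_measurable borel" "h \<in> borel_measurable borel"
      and pos: "\<And>\<sigma>. G \<sigma> \<noteq> 0 \<Longrightarrow> Re (e \<sigma>) > 0" and c: "Re c > 0"
      and ge1: "\<And>\<sigma>. G \<sigma> \<noteq> 0 \<Longrightarrow> Re (e \<sigma>) + Re c \<ge> 1"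
      and fin: "\<And>S. S > 0 \<Longrightarrow> mixture_weight G e S < \<infinity>"
      and h0: "\<And>t. t \<le> a \<Longrightarrow> h t = 0" and hint: "\<And>x. a < x \<Longrightarrow> (\<integral>\<^sup>+t\<in>{a<..<x}. ennreal (norm (h t)) \<partial>lborel) < \<infinity>"
    for G e h :: "real \<Rightarrow> complex" and c :: complex and a x :: real
  proof (rule conjI)
    \<comment> \<open>The maximum with 1 keeps S positive when x \<le> a.\<close>
    define S where "S = max (x - a) 1"
    have S: "S > 0" "x - a \<le> S" by (auto simp: S_def)
    let ?N = "\<lambda>s. \<integral>\<^sup>+u. ennreal (norm (power_kernel c (s - u) * power_mixture G e u)) \<partial>lborel"
    let ?C = "ennreal ((1 + Re c) / Re c * S powr (Re c - 1)) * mixture_weight G e S"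
    have N_le: "?N s \<le> ?C" if s: "0 < s" "s \<le> S" for s
    proof -
      have "?N s \<le> ennreal ((1 + Re c) / Re c * s powr (Re c - 1)) * mixture_weight G e s"
        by (rule conjunct2[OF convolution_power_kernel_power_mixture]) (use pos c fin[OF s(1)] s in auto)
      also have "\<dots> = (\<integral>\<^sup>+\<sigma>. ennreal ((1 + Re c) / Re c * s powr (Re c - 1)) *
                    ennreal (norm (G \<sigma>) * (1 + 1 / Re (e \<sigma>)) * s powr Re (e \<sigma>)) \<partial>lborel)"
        unfolding mixture_weight_def by (rule nn_integral_cmult[symmetric]) measurable
      also have "\<dots> \<le> (\<integral>\<^sup>+\<sigma>. ennreal ((1 + Re c) / Re c * S powr (Re c - 1)) *
                    ennreal (norm (G \<sigma>) * (1 + 1 / Re (e \<sigma>)) * S powr Re (e \<sigma>)) \<partial>lborel)"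
      proof (rule nn_integral_mono)
        fix \<sigma>
        have *: "(1 + Re c) / Re c * s powr (Re c - 1) * (norm (G \<sigma>) * (1 + 1 / Re (e \<sigma>)) * s powr Re (e \<sigma>))
          \<le> (1 + Re c) / Re c * S powr (Re c - 1) * (norm (G \<sigma>) * (1 + 1 / Re (e \<sigma>)) * S powr Re (e \<sigma>))"
          if G: "G \<sigma> \<noteq> 0"
        proof -
          have "s powr (Re c - 1) * s powr Re (e \<sigma>) \<le> S powr (Re c - 1) * S powr Re (e \<sigma>)"
            using ge1[OF G] s by (simp flip: powr_add) (rule powr_mono2, auto)
          then have "((1 + Re c) / Re c * norm (G \<sigma>) * (1 + 1 / Re (e \<sigma>))) * (s powr (Re c - 1) * s powr Re (e \<sigma>))
            \<le> ((1 + Re c) / Re c * norm (G \<sigma>) * (1 + 1 / Re (e \<sigma>))) * (S powr (Re c - 1) * S powr Re (e \<sigma>))"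
            using pos[OF G] c by (intro mult_left_mono) auto
          then show ?thesis by (simp add: mult_ac)
        qed
        show "ennreal ((1 + Re c) / Re c * s powr (Re c - 1)) * ennreal (norm (G \<sigma>) * (1 + 1 / Re (e \<sigma>)) * s powr Re (e \<sigma>))
          \<le> ennreal ((1 + Re c) / Re c * S powr (Re c - 1)) * ennreal (norm (G \<sigma>) * (1 + 1 / Re (e \<sigma>)) * S powr Re (e \<sigma>))"
        proof (cases "G \<sigma> = 0")
          case False
          then show ?thesis using *[OF False] c
            by (subst (1 2) ennreal_mult'[symmetric]) (auto intro!: ennreal_leI)
        qed simp
      qed
      also have "\<dots> = ?C"
        unfolding mixture_weight_def by (rule nn_integral_cmult) measurable
      finally show ?thesis .
    qed
    have "(\<integral>\<^sup>+t. ?N (x - t) * ennreal (norm (h t)) \<partial>lborel)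
        \<le> (\<integral>\<^sup>+t. ?C * (ennreal (norm (h t)) * indicator {a<..<x} t) \<partial>lborel)"
    proof (rule nn_integral_mono)
      fix t
      show "?N (x - t) * ennreal (norm (h t)) \<le> ?C * (ennreal (norm (h t)) * indicator {a<..<x} t)"
      proof (cases "a < t \<and> t < x")
        case True
        then show ?thesis
          using N_le[of "x - t"] S(2) by (auto simp: mult.assoc[symmetric] intro!: mult_right_mono)
      next
        case False
        show ?thesis
        proof (cases "t \<le> a")
          case True then show ?thesis by (simp add: h0)
        next
          case f: False
          have "norm (power_kernel c (x - t - u) * power_mixture G e u) = 0" for u
            using False f by (cases "u \<le> 0") auto
          then have "(\<lambda>u. ennreal (norm (power_kernel c (x - t - u) * power_mixture G e u))) = (\<lambda>u. 0)" by auto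
          then show ?thesis by simp
        qed
      qed
    qed
    also have "\<dots> = ?C * (\<integral>\<^sup>+t\<in>{a<..<x}. ennreal (norm (h t)) \<partial>lborel)"
      by (rule nn_integral_cmult) measurable
    also have "\<dots> < \<infinity>"
      using fin[OF S(1)] hint by (cases "a < x") (auto simp: ennreal_mult_less_top)
    finally have fin': "(\<integral>\<^sup>+t. ?N (x - t) * ennreal (norm (h t)) \<partial>lborel) < \<infinity>" .
    note A = convolution_assoc[OF _ _ _ fin']
    show "integrable lborel (\<lambda>\<tau>. power_kernel c (x - \<tau>) * convolution (power_mixture G e) h \<tau>)"
      by (rule conjunct1[OF A]) measurable
    have "convolution (power_kernel c) (power_mixture G e) = power_mixture (\<lambda>\<sigma>. G \<sigma> * Beta c (e \<sigma>)) (\<lambda>\<sigma>. e \<sigma> + c)"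
    proof
      fix s show "convolution (power_kernel c) (power_mixture G e) s = power_mixture (\<lambda>\<sigma>. G \<sigma> * Beta c (e \<sigma>)) (\<lambda>\<sigma>. e \<sigma> + c) s"
      proof (cases "s > 0")
        case True then show ?thesis by (intro conjunct1[OF convolution_power_kernel_power_mixture]) (use pos c fin in auto)
      next
        case False then show ?thesis by (subst convolution_eq_0[of _ 0]) auto
      qed
    qed
    moreover have "convolution (power_kernel c) (convolution (power_mixture G e) h) x = convolution (convolution (power_kernel c) (power_mixture G e)) h x"
      by (rule conjunct2[OF A]) measurable
    ultimately show "convolution (power_kernel c) (convolution (power_mixture G e) h) x = convolution (power_mixture (\<lambda>\<sigma>. G \<sigma> * Beta c (e \<sigma>)) (\<lambda>\<sigma>. e \<sigma> + c)) h x"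
      by simp
  qed

  \<comment> \<open>The Beta factor consumes 1 + 1 / Re e, and the new exponent brings no new
    singularity because Re (e + c) stays above Re c.\<close>
  have mixture_weight_Beta: "mixture_weight (\<lambda>\<sigma>. G \<sigma> * Beta c (e \<sigma>)) (\<lambda>\<sigma>. e \<sigma> + c) S < \<infinity>"
    if [measurable]: "G \<in> borel_measurable borel" "e \<in> borel_measurable borel"
      and pos: "\<And>\<sigma>. G \<sigma> \<noteq> 0 \<Longrightarrow> Re (e \<sigma>) > 0" and c: "Re c > 0" and S: "S > 0"
      and fin: "mixture_weight G e S < \<infinity>"
    for G e :: "real \<Rightarrow> complex" and c :: complex and S :: real
  proof -
    let ?K = "(1 + Re c) / Re c * (1 + 1 / Re c) * S powr Re c"
    have "mixture_weight (\<lambda>\<sigma>. G \<sigma> * Beta c (e \<sigma>)) (\<lambda>\<sigma>. e \<sigma> + c) S \<le>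
      (\<integral>\<^sup>+\<sigma>. ennreal ?K * ennreal (norm (G \<sigma>) * (1 + 1 / Re (e \<sigma>)) * S powr Re (e \<sigma>)) \<partial>lborel)"
      unfolding mixture_weight_def
    proof (rule nn_integral_mono)
      fix \<sigma>
      show "ennreal (norm (G \<sigma> * Beta c (e \<sigma>)) * (1 + 1 / Re (e \<sigma> + c)) * S powr Re (e \<sigma> + c))
        \<le> ennreal ?K * ennreal (norm (G \<sigma>) * (1 + 1 / Re (e \<sigma>)) * S powr Re (e \<sigma>))"
      proof (cases "G \<sigma> = 0")
        case False
        note e = pos[OF this]
        have "norm (Beta c (e \<sigma>)) \<le> (1 + Re c) / Re c * (1 + 1 / Re (e \<sigma>))"
          using norm_Beta_le[OF c e] Beta_real_bound[OF c e] by linarith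
        moreover have "1 + 1 / Re (e \<sigma> + c) \<le> 1 + 1 / Re c"
          using c e by (simp add: field_simps)
        ultimately have "norm (Beta c (e \<sigma>)) * (1 + 1 / Re (e \<sigma> + c)) \<le>
            ((1 + Re c) / Re c * (1 + 1 / Re (e \<sigma>))) * (1 + 1 / Re c)"
          using c e by (intro mult_mono) auto
        then have "norm (G \<sigma>) * S powr Re (e \<sigma> + c) * (norm (Beta c (e \<sigma>)) * (1 + 1 / Re (e \<sigma> + c))) \<le>
            norm (G \<sigma>) * S powr Re (e \<sigma> + c) * (((1 + Re c) / Re c * (1 + 1 / Re (e \<sigma>))) * (1 + 1 / Re c))"
          by (intro mult_left_mono) auto
        also have "\<dots> = ?K * (norm (G \<sigma>) * (1 + 1 / Re (e \<sigma>)) * S powr Re (e \<sigma>))"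
          by (simp add: powr_add mult_ac)
        finally show ?thesis
          using c by (subst ennreal_mult'[symmetric]) (auto intro!: ennreal_leI simp: norm_mult mult_ac)
      qed simp
    qed
    also have "\<dots> = ennreal ?K * mixture_weight G e S"
      unfolding mixture_weight_def by (rule nn_integral_cmult) measurable
    also have "\<dots> < \<infinity>" using fin by (simp add: ennreal_mult_less_top)
    finally show ?thesis .
  qed

  \<comment> \<open>Local integrability of the weights from convergence at one point\<close>
  have down_closed_nn_integral_ge: "ennreal c * emeasure lborel D \<le> (\<integral>\<^sup>+u\<in>D. f u \<partial>lborel)"
    if [measurable]: "f \<in> borel_measurable borel" "D \<in> sets borel"
      and ge: "\<And>b. 0 < b \<Longrightarrow> b \<le> \<delta> \<Longrightarrow> ennreal (c * b) \<le> (\<integral>\<^sup>+u\<in>{0<..<b}. f u \<partial>lborel)"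
      and D: "D \<subseteq> {0<..<\<delta>}" "\<And>u u'. u \<in> D \<Longrightarrow> 0 < u' \<Longrightarrow> u' \<le> u \<Longrightarrow> u' \<in> D" and c: "c \<ge> 0"
    for f :: "real \<Rightarrow> ennreal" and D :: "real set" and c \<delta> :: real
  proof (cases "D = {}")
    case False
    \<comment> \<open>A nonempty down-closed subset of (0, \<delta>) is (0, b) or (0, b], so the
      growth hypothesis for intervals applies to it.\<close>
    define b where "b = Sup D"
    have bdd: "bdd_above D" using D(1) by (meson bdd_above_Ioo bdd_above_mono)
    obtain u0 where u0: "u0 \<in> D" using False by auto
    then have "u0 \<le> b" unfolding b_def by (rule cSup_upper[OF _ bdd])
    with u0 D(1) have b0: "0 < b" by auto
    have b\<delta>: "b \<le> \<delta>" unfolding b_def using False D(1) by (intro cSup_least) auto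
    have sub: "{0<..<b} \<subseteq> D"
    proof
      fix u assume u: "u \<in> {0<..<b}"
      then obtain u' where "u' \<in> D" "u < u'"
        using less_cSup_iff[OF False bdd] by (auto simp: b_def)
      then show "u \<in> D" using D(2) u by auto
    qed
    have "D \<subseteq> {0..b}"
      using D(1) cSup_upper[OF _ bdd] by (auto simp: b_def)
    then have "emeasure lborel D \<le> emeasure lborel {0..b}"
      by (intro emeasure_mono) auto
    also have "\<dots> = ennreal b" using b0 by simp
    finally have "ennreal c * emeasure lborel D \<le> ennreal c * ennreal b"
      by (rule mult_left_mono) simp
    also have "\<dots> = ennreal (c * b)" using c b0 by (simp add: ennreal_mult)
    also have "\<dots> \<le> (\<integral>\<^sup>+u\<in>{0<..<b}. f u \<partial>lborel)" by (rule ge[OF b0 b\<delta>])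
    also have "\<dots> \<le> (\<integral>\<^sup>+u\<in>D. f u \<partial>lborel)"
      using sub by (intro nn_integral_mono mult_left_mono) (auto simp: indicator_def)
    finally show ?thesis .
  qed simp

  \<comment> \<open>Layer-cake argument: the superlevel sets of the nonincreasing \<open>k\<close> are intervals starting at 0.\<close>
  have antimono_weight_nn_integral_ge: "ennreal c * (\<integral>\<^sup>+u\<in>{0<..<\<delta>}. ennreal (k u) \<partial>lborel) \<le> (\<integral>\<^sup>+u\<in>{0<..<\<delta>}. ennreal (k u) * f u \<partial>lborel)"
    if [measurable]: "f \<in> borel_measurable borel" "k \<in> borel_measurable borel"
      and ge: "\<And>b. 0 < b \<Longrightarrow> b \<le> \<delta> \<Longrightarrow> ennreal (c * b) \<le> (\<integral>\<^sup>+u\<in>{0<..<b}. f u \<partial>lborel)"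
      and k: "\<And>u u'. 0 < u' \<Longrightarrow> u' \<le> u \<Longrightarrow> k u \<le> k u'" "\<And>u. k u \<ge> 0" and c: "c \<ge> 0"
    for f :: "real \<Rightarrow> ennreal" and k :: "real \<Rightarrow> real" and c \<delta> :: real
  proof -
    define D where "D = (\<lambda>l. {u \<in> {0<..<\<delta>}. l < k u})"
    have [measurable]: "D l \<in> sets borel" for l unfolding D_def by measurable
    have kl: "ennreal (k u) * indicator {0<..<\<delta>} u = (\<integral>\<^sup>+l\<in>{0..}. indicator (D l) u \<partial>lborel)" for u
    proof -
      have "(\<integral>\<^sup>+l\<in>{0..}. indicator (D l) u \<partial>lborel) = (\<integral>\<^sup>+l. indicator {0..<k u} l * indicator {0<..<\<delta>} u \<partial>lborel)"
        by (intro nn_integral_cong) (auto simp: D_def indicator_def)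
      also have "\<dots> = (\<integral>\<^sup>+l. indicator {0..<k u} l \<partial>lborel) * indicator {0<..<\<delta>} u"
        by (rule nn_integral_multc) measurable
      finally show ?thesis using k(2)[of u] by simp
    qed
    have [measurable]: "(\<lambda>(u, l). indicator (D l) u :: ennreal) \<in> borel_measurable (borel \<Otimes>\<^sub>M borel)"
      unfolding D_def by measurable
    have "ennreal c * (\<integral>\<^sup>+u\<in>{0<..<\<delta>}. ennreal (k u) \<partial>lborel)
        = ennreal c * (\<integral>\<^sup>+u. \<integral>\<^sup>+l. indicator (D l) u * indicator {0..} l \<partial>lborel \<partial>lborel)"
      by (simp add: kl)
    also have "\<dots> = ennreal c * (\<integral>\<^sup>+l. \<integral>\<^sup>+u. indicator (D l) u * indicator {0..} l \<partial>lborel \<partial>lborel)"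
      by (subst lborel_pair.Fubini') measurable
    also have "\<dots> = (\<integral>\<^sup>+l. ennreal c * emeasure lborel (D l) * indicator {0..} l \<partial>lborel)"
    proof (subst nn_integral_cmult[symmetric])
      show "(\<lambda>l. \<integral>\<^sup>+u. indicator (D l) u * indicator {0..} l \<partial>lborel) \<in> borel_measurable lborel"
        by measurable
      show "(\<integral>\<^sup>+l. ennreal c * (\<integral>\<^sup>+u. indicator (D l) u * indicator {0..} l \<partial>lborel) \<partial>lborel)
        = (\<integral>\<^sup>+l. ennreal c * emeasure lborel (D l) * indicator {0..} l \<partial>lborel)"
        by (simp add: nn_integral_multc mult.assoc)
    qed
    also have "\<dots> \<le> (\<integral>\<^sup>+l. (\<integral>\<^sup>+u\<in>D l. f u \<partial>lborel) * indicator {0..} l \<partial>lborel)"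
    proof (intro nn_integral_mono mult_right_mono down_closed_nn_integral_ge)
      fix l u u' assume "u \<in> D l" "0 < u'" "u' \<le> u"
      then show "u' \<in> D l" using k(1)[of u' u] by (auto simp: D_def)
    qed (use ge c in \<open>auto simp: D_def\<close>)
    also have "\<dots> = (\<integral>\<^sup>+l. \<integral>\<^sup>+u. f u * (indicator (D l) u * indicator {0..} l) \<partial>lborel \<partial>lborel)"
      by (simp add: nn_integral_multc[symmetric] mult.assoc)
    also have "\<dots> = (\<integral>\<^sup>+u. \<integral>\<^sup>+l. f u * (indicator (D l) u * indicator {0..} l) \<partial>lborel \<partial>lborel)"
      by (subst lborel_pair.Fubini') measurable
    also have "\<dots> = (\<integral>\<^sup>+u. f u * (ennreal (k u) * indicator {0<..<\<delta>} u) \<partial>lborel)"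
      unfolding kl by (intro nn_integral_cong nn_integral_cmult) measurable
    finally show ?thesis by (simp add: mult_ac)
  qed

  have nn_integral_powr_near_0: "(\<integral>\<^sup>+u\<in>{0<..<\<delta>}. ennreal (u powr (p - 1)) \<partial>lborel) = (if p > 0 then ennreal (\<delta> powr p / p) else \<infinity>)"
    if \<delta>: "\<delta> > 0"
    for p \<delta> :: real
  proof -
    have pos: "(\<integral>\<^sup>+u\<in>{0<..<\<delta>}. ennreal (u powr (q - 1)) \<partial>lborel) = ennreal (\<delta> powr q / q)"
      if q: "q > 0" and \<delta>: "\<delta> > 0" for q \<delta> :: real
    proof -
      have "((\<lambda>u. u powr (q - 1)) has_integral (\<delta> powr (q - 1 + 1) / (q - 1 + 1))) {0..\<delta>}"
        by (rule has_integral_powr_from_0) (use q \<delta> in auto)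
      then have "((\<lambda>u. u powr (q - 1)) has_integral (\<delta> powr q / q)) {0..\<delta>}" by simp
      then have "((\<lambda>u. u powr (q - 1)) has_integral (\<delta> powr q / q)) {0<..<\<delta>}"
        by (simp add: has_integral_Icc_iff_Ioo)
      from nn_integral_has_integral_lebesgue[OF _ this]
      have "(\<integral>\<^sup>+u. ennreal (indicator {0<..<\<delta>} u * u powr (q - 1)) \<partial>lborel) = ennreal (\<delta> powr q / q)"
        by simp
      moreover have "ennreal (u powr (q - 1)) * indicator {0<..<\<delta>} u = ennreal (indicator {0<..<\<delta>} u * u powr (q - 1))" for u
        by (simp add: indicator_def)
      ultimately show ?thesis by simp
    qed
    show ?thesis
    proof (cases "p > 0")
      case True
      then show ?thesis using pos \<delta> by simp
    next
      case False
      let ?I = "\<integral>\<^sup>+u\<in>{0<..<\<delta>}. ennreal (u powr (p - 1)) \<partial>lborel"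
      define d where "d = min \<delta> 1"
      have d: "0 < d" "d \<le> \<delta>" "d \<le> 1" using \<delta> by (auto simp: d_def)
      \<comment> \<open>On (0, d), where u < 1, the integrand dominates u powr (q - 1) for q = 1 /
        Suc n; the integral d powr q / q of the latter is at least Suc n * d, and n is
        arbitrary.\<close>
      have ge: "ennreal (real (Suc n) * d) \<le> ?I" for n
      proof -
        let ?q = "1 / real (Suc n)"
        have "d powr 1 \<le> d powr ?q" using d by (intro powr_mono') auto
        then have "ennreal (real (Suc n) * d) \<le> ennreal (d powr ?q / ?q)"
          using d by (intro ennreal_leI) (simp add: mult.commute mult_right_mono)
        also have "\<dots> = (\<integral>\<^sup>+u\<in>{0<..<d}. ennreal (u powr (?q - 1)) \<partial>lborel)"
          using d by (intro pos[symmetric]) auto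
        also have "\<dots> \<le> ?I"
        proof (rule nn_integral_mono)
          fix u
          have "u powr (?q - 1) \<le> u powr (p - 1)" if "0 < u" "u < d"
            using that d False by (intro powr_mono') (auto intro: order_trans[of _ 0])
          then show "ennreal (u powr (?q - 1)) * indicator {0<..<d} u \<le> ennreal (u powr (p - 1)) * indicator {0<..<\<delta>} u"
            using d by (auto simp: indicator_def intro!: ennreal_leI)
        qed
        finally show ?thesis .
      qed
      have "?I = \<infinity>"
      proof (rule ccontr)
        assume "?I \<noteq> \<infinity>"
        then obtain y where y: "y \<ge> 0" "?I = ennreal y" by (cases ?I) auto
        obtain n where "y < real n * d" using reals_Archimedean3[OF d(1)] by blast
        also have "\<dots> \<le> real (Suc n) * d" using d by simp
        finally show False using ge[of n] y d by (simp add: ennreal_le_iff)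
      qed
      then show ?thesis using False by simp
    qed
  qed

  \<comment> \<open>Finiteness of the convolution at a single point where the primitive of the density grows at
    least linearly forces local integrability of the power weights. The integral of \<open>u powr (p - 1)\<close>
    near 0 is of order \<open>1 / p\<close>, which is the origin of the factor \<open>1 + 1 / Re (e \<sigma>)\<close>.\<close>
  have mixture_weight_finite: "(AE \<sigma> in lborel. G \<sigma> = 0 \<or> Re (e \<sigma>) > 0) \<and>
      (\<forall>S>0. (\<integral>\<^sup>+\<sigma>. ennreal (norm (G \<sigma>) * (1 + 1 / Re (e \<sigma>)) * S powr Re (e \<sigma>)) * indicator {\<sigma>. 0 < Re (e \<sigma>)} \<sigma> \<partial>lborel) < \<infinity>)"
    if [measurable]: "f \<in> borel_measurable borel" "G \<in> borel_measurable borel" "e \<in> borel_measurable borel"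
      and c: "c > 0" and \<delta>: "\<delta> > 0"
      and ge: "\<And>b. 0 < b \<Longrightarrow> b \<le> \<delta> \<Longrightarrow> ennreal (c * b) \<le> (\<integral>\<^sup>+u\<in>{0<..<b}. f u \<partial>lborel)"
      and fin: "(\<integral>\<^sup>+u\<in>{0<..<\<delta>}. f u * (\<integral>\<^sup>+\<sigma>. ennreal (norm (G \<sigma>) * u powr (Re (e \<sigma>) - 1)) \<partial>lborel) \<partial>lborel) < \<infinity>"
      and int: "\<And>S. S > 0 \<Longrightarrow> (\<integral>\<^sup>+\<sigma>. ennreal (norm (G \<sigma>) * S powr Re (e \<sigma>)) \<partial>lborel) < \<infinity>"
    for f :: "real \<Rightarrow> ennreal" and G e :: "real \<Rightarrow> complex" and c \<delta> :: real
  proof (intro conjI allI impI)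
    let ?I = "\<lambda>\<sigma>. \<integral>\<^sup>+u\<in>{0<..<\<delta>}. ennreal (u powr (Re (e \<sigma>) - 1)) \<partial>lborel"
    \<comment> \<open>On \<open>?Z\<close> the power of u is nonincreasing, as the layer-cake bound
      requires. Off \<open>?Z\<close> the factor 1 + 1 / Re (e \<sigma>) is at most 2, and
      \<open>int\<close> suffices.\<close>
    let ?Z = "{\<sigma>. Re (e \<sigma>) \<le> 1}"
    have [measurable]: "?Z \<in> sets borel" "{\<sigma>. 0 < Re (e \<sigma>)} \<in> sets borel" by measurable
    have "(\<integral>\<^sup>+\<sigma>. (ennreal c * ennreal (norm (G \<sigma>)) * ?I \<sigma>) * indicator ?Z \<sigma> \<partial>lborel)
      \<le> (\<integral>\<^sup>+\<sigma>. ennreal (norm (G \<sigma>)) * (\<integral>\<^sup>+u\<in>{0<..<\<delta>}. ennreal (u powr (Re (e \<sigma>) - 1)) * f u \<partial>lborel) \<partial>lborel)"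
    proof (rule nn_integral_mono)
      fix \<sigma>
      have "ennreal c * ?I \<sigma> \<le> (\<integral>\<^sup>+u\<in>{0<..<\<delta>}. ennreal (u powr (Re (e \<sigma>) - 1)) * f u \<partial>lborel)" if "\<sigma> \<in> ?Z"
      proof (rule antimono_weight_nn_integral_ge)
        fix u u' :: real assume "0 < u'" "u' \<le> u"
        then show "u powr (Re (e \<sigma>) - 1) \<le> u' powr (Re (e \<sigma>) - 1)"
          using that by (intro powr_mono2') auto
      qed (use ge c in auto)
      then have "ennreal (norm (G \<sigma>)) * (ennreal c * ?I \<sigma>) \<le>
          ennreal (norm (G \<sigma>)) * (\<integral>\<^sup>+u\<in>{0<..<\<delta>}. ennreal (u powr (Re (e \<sigma>) - 1)) * f u \<partial>lborel)" if "\<sigma> \<in> ?Z"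
        using that by (intro mult_left_mono) auto
      then show "(ennreal c * ennreal (norm (G \<sigma>)) * ?I \<sigma>) * indicator ?Z \<sigma>
        \<le> ennreal (norm (G \<sigma>)) * (\<integral>\<^sup>+u\<in>{0<..<\<delta>}. ennreal (u powr (Re (e \<sigma>) - 1)) * f u \<partial>lborel)"
        by (cases "\<sigma> \<in> ?Z") (auto simp: mult_ac)
    qed
    also have "\<dots> = (\<integral>\<^sup>+\<sigma>. \<integral>\<^sup>+u. ennreal (norm (G \<sigma>)) * (ennreal (u powr (Re (e \<sigma>) - 1)) * f u * indicator {0<..<\<delta>} u) \<partial>lborel \<partial>lborel)"
      by (intro nn_integral_cong nn_integral_cmult[symmetric]) measurable
    also have "\<dots> = (\<integral>\<^sup>+u. \<integral>\<^sup>+\<sigma>. ennreal (norm (G \<sigma>)) * (ennreal (u powr (Re (e \<sigma>) - 1)) * f u * indicator {0<..<\<delta>} u) \<partial>lborel \<partial>lborel)"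
      by (rule lborel_pair.Fubini') measurable
    also have "\<dots> = (\<integral>\<^sup>+u. \<integral>\<^sup>+\<sigma>. (f u * indicator {0<..<\<delta>} u) * ennreal (norm (G \<sigma>) * u powr (Re (e \<sigma>) - 1)) \<partial>lborel \<partial>lborel)"
      by (simp add: ennreal_mult mult_ac)
    also have "\<dots> = (\<integral>\<^sup>+u. (f u * indicator {0<..<\<delta>} u) * (\<integral>\<^sup>+\<sigma>. ennreal (norm (G \<sigma>) * u powr (Re (e \<sigma>) - 1)) \<partial>lborel) \<partial>lborel)"
      by (intro nn_integral_cong nn_integral_cmult) measurable
    also have "\<dots> < \<infinity>"
      using fin by (simp add: mult_ac)
    finally have fin2: "(\<integral>\<^sup>+\<sigma>. (ennreal c * ennreal (norm (G \<sigma>)) * ?I \<sigma>) * indicator ?Z \<sigma> \<partial>lborel) < \<infinity>" .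
    \<comment> \<open>Where Re (e \<sigma>) \<le> 0 the inner integral \<open>?I\<close> is
      infinite, so the finite outer integral forces G to vanish there almost everywhere.\<close>
    have "AE \<sigma> in lborel. (ennreal c * ennreal (norm (G \<sigma>)) * ?I \<sigma>) * indicator ?Z \<sigma> \<noteq> \<infinity>"
      by (rule nn_integral_noteq_infinite) (use fin2 in auto)
    then show "AE \<sigma> in lborel. G \<sigma> = 0 \<or> Re (e \<sigma>) > 0"
    proof eventually_elim
      case (elim \<sigma>)
      show ?case
      proof (rule ccontr)
        assume "\<not> (G \<sigma> = 0 \<or> Re (e \<sigma>) > 0)"
        then show False
          using elim c nn_integral_powr_near_0[OF \<delta>, of "Re (e \<sigma>)"]
          by (auto simp: ennreal_mult_eq_top_iff)
      qed
    qed
    fix S :: real assume S: "S > 0"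
    \<comment> \<open>For 0 < p \<le> 1 one has 1 + 1 / p \<le> 2 / p, S powr p \<le> max 1 S and
      min \<delta> 1 \<le> \<delta> powr p. \<open>M\<close> collects these constants in the
      comparison with c * \<delta> powr p / p.\<close>
    define M where "M = 2 * max 1 S / (c * min \<delta> 1)"
    have M: "M \<ge> 0" using c S \<delta> by (auto simp: M_def)
    have "(\<integral>\<^sup>+\<sigma>. ennreal (norm (G \<sigma>) * (1 + 1 / Re (e \<sigma>)) * S powr Re (e \<sigma>)) * indicator {\<sigma>. 0 < Re (e \<sigma>)} \<sigma> \<partial>lborel)
      \<le> (\<integral>\<^sup>+\<sigma>. 2 * ennreal (norm (G \<sigma>) * S powr Re (e \<sigma>)) +
          ennreal M * ((ennreal c * ennreal (norm (G \<sigma>)) * ?I \<sigma>) * indicator ?Z \<sigma>) \<partial>lborel)"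
    proof (rule nn_integral_mono)
      fix \<sigma>
      let ?L = "norm (G \<sigma>) * (1 + 1 / Re (e \<sigma>)) * S powr Re (e \<sigma>)"
      consider "Re (e \<sigma>) \<le> 0" | "Re (e \<sigma>) > 1" | "0 < Re (e \<sigma>)" "Re (e \<sigma>) \<le> 1" by linarith
      then show "ennreal ?L * indicator {\<sigma>. 0 < Re (e \<sigma>)} \<sigma> \<le> 2 * ennreal (norm (G \<sigma>) * S powr Re (e \<sigma>)) +
          ennreal M * ((ennreal c * ennreal (norm (G \<sigma>)) * ?I \<sigma>) * indicator ?Z \<sigma>)"
      proof cases
        case 2
        have "norm (G \<sigma>) * (1 + 1 / Re (e \<sigma>)) * S powr Re (e \<sigma>) \<le> norm (G \<sigma>) * 2 * S powr Re (e \<sigma>)"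
          using 2 by (intro mult_right_mono mult_left_mono) auto
        then have "ennreal ?L \<le> 2 * ennreal (norm (G \<sigma>) * S powr Re (e \<sigma>))"
          by (subst ennreal_numeral[symmetric], subst ennreal_mult[symmetric]) (auto intro!: ennreal_leI simp: mult_ac)
        then show ?thesis using 2 by (simp add: add_increasing2)
      next
        case 3
        let ?p = "Re (e \<sigma>)"
        have a: "1 + 1 / ?p \<le> 2 / ?p" using 3 by (simp add: field_simps)
        have b: "S powr ?p \<le> max 1 S"
        proof (cases "S \<ge> 1")
          case True then have "S powr ?p \<le> S powr 1" using 3 by (intro powr_mono) auto
          then show ?thesis using True by simp
        next
          case False then have "S powr ?p \<le> 1" using 3 S by (intro powr_le1) auto
          then show ?thesis by simp
        qed
        have d: "min \<delta> 1 \<le> \<delta> powr ?p"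
        proof (cases "\<delta> \<ge> 1")
          case True then have "1 \<le> \<delta> powr ?p" using 3 by (intro ge_one_powr_ge_zero) auto
          then show ?thesis using True by simp
        next
          case False then have "\<delta> powr 1 \<le> \<delta> powr ?p" using 3 \<delta> by (intro powr_mono') auto
          then show ?thesis using False \<delta> by simp
        qed
        have dp: "min \<delta> 1 \<noteq> 0" using \<delta> by (simp add: min_def)
        have "?L \<le> norm (G \<sigma>) * (2 / ?p) * max 1 S"
          using a b 3 by (intro mult_mono mult_left_mono) auto
        also have "\<dots> = M * (c * norm (G \<sigma>) * (min \<delta> 1 / ?p))"
          using c dp by (simp add: M_def)
        also have "\<dots> \<le> M * (c * norm (G \<sigma>) * (\<delta> powr ?p / ?p))"
          using d 3 c M by (intro mult_left_mono divide_right_mono) auto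
        finally have "ennreal ?L \<le> ennreal (M * (c * norm (G \<sigma>) * (\<delta> powr ?p / ?p)))"
          by (rule ennreal_leI)
        also have "\<dots> = ennreal M * ((ennreal c * ennreal (norm (G \<sigma>)) * ?I \<sigma>) * indicator ?Z \<sigma>)"
          using 3 nn_integral_powr_near_0[OF \<delta>, of ?p] c M
          by (simp add: ennreal_mult del: times_divide_eq_right times_divide_eq_left)
        finally show ?thesis using 3 by (simp add: add_increasing)
      qed simp
    qed
    also have "\<dots> = 2 * (\<integral>\<^sup>+\<sigma>. ennreal (norm (G \<sigma>) * S powr Re (e \<sigma>)) \<partial>lborel) +
          ennreal M * (\<integral>\<^sup>+\<sigma>. (ennreal c * ennreal (norm (G \<sigma>)) * ?I \<sigma>) * indicator ?Z \<sigma> \<partial>lborel)"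
      by (simp add: nn_integral_add nn_integral_cmult)
    also have "\<dots> < \<infinity>"
      using fin2 int[OF S] by (simp add: ennreal_mult_less_top)
    finally show "(\<integral>\<^sup>+\<sigma>. ennreal (norm (G \<sigma>) * (1 + 1 / Re (e \<sigma>)) * S powr Re (e \<sigma>)) * indicator {\<sigma>. 0 < Re (e \<sigma>)} \<sigma> \<partial>lborel) < \<infinity>" .
  qed

  \<comment> \<open>Setup, and the case of a vanishing density\<close>
  define P where "P = (\<lambda>t. if a < t then \<phi> t else 0)"
  have \<alpha>: "\<alpha> > 0" and w: "w \<noteq> 0" and m: "m \<le> length B" and \<mu>: "Re \<mu> > 0"
    and def1: "\<And>s. s > 0 \<Longrightarrow> fox_H_defined m n A B (w * of_real (s powr \<alpha>))"
    and def2: "\<And>s. s > 0 \<Longrightarrow> fox_H_defined m (n + 2) A' B' (w * of_real (s powr \<alpha>))"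
    and \<phi>: "\<And>c. c > a \<Longrightarrow> set_integrable lborel {a..c} \<phi>"
    by fact+
  have r: "rl_order \<mu> = r" "r \<ge> 1" and r\<mu>: "Re (of_nat r - \<mu>) > 0"
  proof -
    show "rl_order \<mu> = r" "r \<ge> 1" by (simp_all add: rl_order_def r_def)
    have "real r = of_int \<lfloor>Re \<mu>\<rfloor> + 1" using \<mu> by (simp add: r_def)
    then show "Re (of_nat r - \<mu>) > 0" by simp
  qed
  obtain L where L2: "fox_contour m (n + 2) A' B' L"
    and int2: "\<And>s. s > 0 \<Longrightarrow> integrable lborel (fox_integrand m (n + 2) A' B' L (w * of_real (s powr \<alpha>)))"
    and fin2: "AE x in lborel. a < x \<longrightarrow> fox_op_abs a w m (n + 2) \<alpha> (\<beta> - \<mu>) A' B' L \<phi> x < \<infinity>"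
    using assms(20) by blast
  show ?thesis
  proof (cases "AE t in lborel. a < t \<longrightarrow> \<phi> t = 0")
    \<comment> \<open>Convergence now carries no information about the contour integrand, but both
      sides are 0.\<close>
    case True
    have zero: "fox_op a w m' n' \<alpha> \<beta>' A1 B1 \<phi> x = 0" for m' n' \<beta>' A1 B1 x
      unfolding fox_op_def set_lebesgue_integral_def
      by (rule integral_eq_zero_AE) (use True in \<open>auto elim!: eventually_mono simp: indicator_def\<close>)
    have vz: "(vderiv ^^ k) (\<lambda>x. 0) = (\<lambda>x. 0)" for k
      by (induction k) (auto simp: vderiv_def)
    have "fox_op a w m n \<alpha> \<beta> A B \<phi> = (\<lambda>x. 0)" using zero by auto
    moreover have "rl_integral c a (\<lambda>x. 0) = (\<lambda>x. 0)" for c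
      by (simp add: rl_integral_def fun_eq_iff set_lebesgue_integral_def)
    ultimately have "rl_derivative \<mu> a (fox_op a w m n \<alpha> \<beta> A B \<phi>) x = 0" for x
      by (simp add: rl_derivative_def vz)
    then show ?thesis by (simp add: zero)
  next
    case nz: False
    \<comment> \<open>Integrability of \<phi> is given on compact intervals starting at a, with
      nothing said to the left of a; \<open>P\<close> is the limit of the truncations to (a, a +
      i].\<close>
    have P_meas [measurable]: "P \<in> borel_measurable borel"
    proof (rule borel_measurable_LIMSEQ_metric)
      fix i :: nat
      have "set_integrable lborel {a<..a + real i} \<phi>"
        by (rule set_integrable_subset[OF \<phi>[of "a + real i + 1"]]) auto
      then show "(\<lambda>t. indicator {a<..a + real i} t *\<^sub>R \<phi> t) \<in> borel_measurable borel"
        by (auto simp: set_integrable_def dest: borel_measurable_integrable)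
    next
      fix t :: real
      obtain N where N: "t - a \<le> real N" using real_arch_simple by blast
      have "indicator {a<..a + real i} t *\<^sub>R \<phi> t = P t" if "i \<ge> N" for i
      proof -
        have "real N \<le> real i" using that by simp
        then show ?thesis using N by (auto simp: P_def indicator_def)
      qed
      then show "(\<lambda>i. indicator {a<..a + real i} t *\<^sub>R \<phi> t) \<longlonglongrightarrow> P t"
        by (intro tendsto_eventually) (auto simp: eventually_sequentially)
    qed
    have P0: "P t = 0" if "t \<le> a" for t using that by (simp add: P_def)
    have Pint: "(\<integral>\<^sup>+t\<in>{a<..<x}. ennreal (norm (P t)) \<partial>lborel) < \<infinity>" if "a < x" for x
    proof -
      have "(\<integral>\<^sup>+t\<in>{a<..<x}. ennreal (norm (P t)) \<partial>lborel) \<le> (\<integral>\<^sup>+t. ennreal (norm (indicator {a..x} t *\<^sub>R \<phi> t)) \<partial>lborel)"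
        by (intro nn_integral_mono) (auto simp: P_def indicator_def)
      also have "\<dots> < \<infinity>"
        using \<phi>[OF that] by (simp add: set_integrable_def integrable_iff_bounded)
      finally show ?thesis .
    qed
    have [measurable]: "L \<in> borel_measurable borel"
      by (rule borel_measurable_continuous_onI[OF fox_contour_continuous[OF L2]])
    define v where "v = (\<lambda>\<sigma>. \<beta> - \<mu> + of_real \<alpha> * L \<sigma>)"
    have [measurable]: "v \<in> borel_measurable borel" unfolding v_def by measurable
    define D1 where "D1 = fox_density m n A B L w"
    define D2 where "D2 = fox_density m (n + 2) A' B' L w"
    have D2_meas [measurable]: "D2 \<in> borel_measurable borel"
      using borel_measurable_integrable[OF int2[of 1]] by (simp add: D2_def fox_density_def[abs_def])
    \<comment> \<open>\<open>G\<close> agrees with \<open>D2\<close> almost everywhere, but its exponents all have positive real part.\<close>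
    define G where "G = (\<lambda>\<sigma>. if Re (v \<sigma>) > 0 then D2 \<sigma> else 0)"
    have [measurable]: "G \<in> borel_measurable borel" unfolding G_def by measurable
    have pos: "Re (v \<sigma>) > 0" if "G \<sigma> \<noteq> 0" for \<sigma> using that by (auto simp: G_def split: if_splits)

    \<comment> \<open>A density point of \<phi> and the finiteness of the weights\<close>
    obtain x c \<delta> where x: "a < x" "fox_op_abs a w m (n + 2) \<alpha> (\<beta> - \<mu>) A' B' L \<phi> x < \<infinity>"
      and c: "c > 0" "\<delta> > 0" "\<delta> \<le> x - a"
      and growth: "\<And>b. 0 < b \<Longrightarrow> b \<le> \<delta> \<Longrightarrow> ennreal (c * b) \<le> (\<integral>\<^sup>+u\<in>{0<..<b}. ennreal (norm (\<phi> (x - u))) \<partial>lborel)"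
    proof -
      let ?f = "\<lambda>t. norm (\<phi> t)"
      have si: "set_integrable lborel {a..y} ?f" for y
        by (rule set_integrable_subset[OF set_integrable_norm[OF \<phi>[of "max y (a + 1)"]]]) auto
      have io: "?f integrable_on {a..y}" for y
        using si by (rule set_borel_integral_eq_integral)
      have "AE x in lborel. \<forall>n. a < x \<and> x < real n \<longrightarrow>
          ((\<lambda>y. integral {a..y} ?f) has_vector_derivative ?f x) (at x)"
        unfolding AE_all_countable by (intro allI AE_integral_has_vector_derivative io)
      with fin2 have "AE x in lborel. a < x \<longrightarrow> fox_op_abs a w m (n + 2) \<alpha> (\<beta> - \<mu>) A' B' L \<phi> x < \<infinity> \<and> ((\<lambda>y. integral {a..y} ?f) has_vector_derivative ?f x) (at x)"
        by eventually_elim (use reals_Archimedean2 in blast)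
      \<comment> \<open>Two of the properties hold almost everywhere on (a, \<infinity>) and \<phi>
        is not almost everywhere 0 there, so all of them meet at one point.\<close>
      then have "\<exists>x. a < x \<and> fox_op_abs a w m (n + 2) \<alpha> (\<beta> - \<mu>) A' B' L \<phi> x < \<infinity> \<and> \<phi> x \<noteq> 0 \<and> ((\<lambda>y. integral {a..y} ?f) has_vector_derivative ?f x) (at x)"
        (is "Ex ?Q")
      proof (rule contrapos_pp)
        assume none: "\<not> Ex ?Q"
        show "\<not> (AE x in lborel. a < x \<longrightarrow> fox_op_abs a w m (n + 2) \<alpha> (\<beta> - \<mu>) A' B' L \<phi> x < \<infinity> \<and> ((\<lambda>y. integral {a..y} ?f) has_vector_derivative ?f x) (at x))"
        proof
          assume "AE x in lborel. a < x \<longrightarrow> fox_op_abs a w m (n + 2) \<alpha> (\<beta> - \<mu>) A' B' L \<phi> x < \<infinity> \<and> ((\<lambda>y. integral {a..y} ?f) has_vector_derivative ?f x) (at x)"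
          then have "AE x in lborel. a < x \<longrightarrow> \<phi> x = 0"
            by eventually_elim (use none in blast)
          with nz show False ..
        qed
      qed
      then obtain x where x: "a < x" "fox_op_abs a w m (n + 2) \<alpha> (\<beta> - \<mu>) A' B' L \<phi> x < \<infinity>" "\<phi> x \<noteq> 0" "((\<lambda>y. integral {a..y} ?f) has_vector_derivative ?f x) (at x)"
        by blast
      \<comment> \<open>Half of the derivative: the approximation error c * b then costs only half
        of b * norm (\<phi> x).\<close>
      define c where "c = ?f x / 2"
      have c: "c > 0" using x by (simp add: c_def)
      obtain d where d: "d > 0" and dd: "\<And>y. norm (y - x) < d \<Longrightarrow>
          norm (integral {a..y} ?f - integral {a..x} ?f - (y - x) *\<^sub>R ?f x) \<le> c * norm (y - x)"
        using x(4) c unfolding has_vector_derivative_def has_derivative_at_alt by blast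
      \<comment> \<open>With d / 2 the value b = \<delta> still satisfies the strict inequality in
        \<open>dd\<close>.\<close>
      define \<delta> where "\<delta> = min (d / 2) (x - a)"
      have \<delta>: "\<delta> > 0" "\<delta> < d" "\<delta> \<le> x - a" using d x by (auto simp: \<delta>_def min_def)
      show ?thesis
      proof (rule that[OF x(1,2) c \<delta>(1) \<delta>(3)])
        fix b assume b: "0 < b" "b \<le> \<delta>"
        have "norm (integral {a..x - b} ?f - integral {a..x} ?f - (x - b - x) *\<^sub>R ?f x) \<le> c * norm (x - b - x)"
          using b \<delta> by (intro dd) auto
        then have "\<bar>integral {a..x - b} ?f - integral {a..x} ?f + b * ?f x\<bar> \<le> c * b" using b by simp
        moreover have "integral {a..x - b} ?f + integral {x - b..x} ?f = integral {a..x} ?f"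
          using b \<delta> by (intro Henstock_Kurzweil_Integration.integral_combine io) auto
        moreover have "b * ?f x = 2 * (c * b)" by (simp add: c_def)
        ultimately have "c * b \<le> integral {x - b..x} ?f"
          by linarith
        also have "\<dots> = integral {x - b<..<x} ?f"
          by (simp add: integral_open_interval_real)
        finally have le: "c * b \<le> integral {x - b<..<x} ?f" .
        have si': "set_integrable lborel {x - b<..<x} ?f"
          by (rule set_integrable_subset[OF si[of x]]) (use b \<delta> in auto)
        define h where "h = (\<lambda>t. indicator {x - b<..<x} t *\<^sub>R ?f t)"
        have [measurable]: "h \<in> borel_measurable borel"
          using borel_measurable_integrable[OF si'[unfolded set_integrable_def]] by (simp add: h_def)
        have "ennreal (integral {x - b<..<x} ?f) = (\<integral>\<^sup>+t. ennreal (h t) \<partial>lborel)"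
          using set_borel_integral_eq_integral(2)[OF si'] nn_integral_eq_integral[OF si'[unfolded set_integrable_def]]
          by (simp add: set_lebesgue_integral_def h_def)
        also have "\<dots> = (\<integral>\<^sup>+u. ennreal (h (x - u)) \<partial>lborel)"
          by (rule nn_integral_reflect[symmetric]) measurable
        also have "\<dots> = (\<integral>\<^sup>+u\<in>{0<..<b}. ennreal (norm (\<phi> (x - u))) \<partial>lborel)"
          by (intro nn_integral_cong) (auto simp: indicator_def h_def)
        finally show "ennreal (c * b) \<le> (\<integral>\<^sup>+u\<in>{0<..<b}. ennreal (norm (\<phi> (x - u))) \<partial>lborel)"
          using ennreal_leI[OF le] by simp
      qed
    qed
    have growth': "ennreal (c * b) \<le> (\<integral>\<^sup>+u\<in>{0<..<b}. ennreal (norm (P (x - u))) \<partial>lborel)" if "0 < b" "b \<le> \<delta>" for b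
    proof -
      have "(\<integral>\<^sup>+u\<in>{0<..<b}. ennreal (norm (\<phi> (x - u))) \<partial>lborel) = (\<integral>\<^sup>+u\<in>{0<..<b}. ennreal (norm (P (x - u))) \<partial>lborel)"
        using that c by (intro nn_integral_cong) (auto simp: P_def indicator_def)
      then show ?thesis using growth[OF that] by simp
    qed
    have abs_fin: "(\<integral>\<^sup>+u\<in>{0<..<\<delta>}. ennreal (norm (P (x - u))) *
      (\<integral>\<^sup>+\<sigma>. ennreal (norm (D2 \<sigma>) * u powr (Re (v \<sigma>) - 1)) \<partial>lborel) \<partial>lborel) < \<infinity>"
      using fox_op_abs_ge[OF w c(3) D2_meas[unfolded D2_def] _ P_meas[unfolded P_def], of "\<beta> - \<mu>" \<alpha>] x(2)
      unfolding D2_def v_def P_def by (auto intro: le_less_trans)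
    have D2_int: "(\<integral>\<^sup>+\<sigma>. ennreal (norm (D2 \<sigma>) * S powr Re (v \<sigma>)) \<partial>lborel) < \<infinity>" if S: "S > 0" for S
    proof -
      let ?N = "norm (complex_of_real S powr (\<beta> - \<mu> - 1))"
      have eq: "norm (D2 \<sigma>) * S powr Re (v \<sigma>) = norm ((S / (2 * pi) * ?N) *\<^sub>R fox_integrand m (n + 2) A' B' L (w * of_real (S powr \<alpha>)) \<sigma>)" for \<sigma>
      proof -
        have "norm ((S / (2 * pi) * ?N) *\<^sub>R fox_integrand m (n + 2) A' B' L (w * of_real (S powr \<alpha>)) \<sigma>)
          = S / (2 * pi) * (?N * norm (fox_integrand m (n + 2) A' B' L (w * of_real (S powr \<alpha>)) \<sigma>))"
          using S by (simp add: abs_mult)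
        also have "\<dots> = norm (D2 \<sigma>) * (S powr (Re (v \<sigma>) - 1) * S)"
          unfolding norm_fox_integrand_scale[OF S w] by (simp add: D2_def v_def)
        also have "S powr (Re (v \<sigma>) - 1) * S = S powr Re (v \<sigma>)"
          using S by (simp add: powr_diff)
        finally show ?thesis by simp
      qed
      have "integrable lborel (\<lambda>\<sigma>. (S / (2 * pi) * ?N) *\<^sub>R fox_integrand m (n + 2) A' B' L (w * of_real (S powr \<alpha>)) \<sigma>)"
        by (rule integrable_scaleR_right[OF int2[OF S]])
      then show ?thesis
        unfolding eq integrable_iff_bounded by (rule conjunct2)
    qed
    have wf_pos: "AE \<sigma> in lborel. D2 \<sigma> = 0 \<or> Re (v \<sigma>) > 0"
      by (rule conjunct1[OF mixture_weight_finite[OF _ D2_meas _ c(1,2) growth' abs_fin D2_int]]) auto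
    have wf_int: "\<forall>S>0. (\<integral>\<^sup>+\<sigma>. ennreal (norm (D2 \<sigma>) * (1 + 1 / Re (v \<sigma>)) * S powr Re (v \<sigma>)) * indicator {\<sigma>. 0 < Re (v \<sigma>)} \<sigma> \<partial>lborel) < \<infinity>"
      by (rule conjunct2[OF mixture_weight_finite[OF _ D2_meas _ c(1,2) growth' abs_fin D2_int]]) auto
    have AE_G: "AE \<sigma> in lborel. G \<sigma> = D2 \<sigma>"
      using wf_pos by (auto simp: G_def elim!: eventually_mono)
    have weight0: "mixture_weight G v S < \<infinity>" if "S > 0" for S
    proof -
      have "mixture_weight G v S = (\<integral>\<^sup>+\<sigma>. ennreal (norm (D2 \<sigma>) * (1 + 1 / Re (v \<sigma>)) * S powr Re (v \<sigma>)) * indicator {\<sigma>. 0 < Re (v \<sigma>)} \<sigma> \<partial>lborel)"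
        unfolding mixture_weight_def by (intro nn_integral_cong) (auto simp: G_def indicator_def)
      also have "\<dots> < \<infinity>"
        using wf_int that by blast
      finally show ?thesis .
    qed

    \<comment> \<open>Iterated integrals of the right-hand side\<close>
    define GG where "GG = (\<lambda>k \<sigma>. G \<sigma> * (Gamma (v \<sigma>) * rGamma (v \<sigma> + of_nat k)))"
    have Gm: "(Gamma :: complex \<Rightarrow> complex) \<in> borel_measurable borel" "(rGamma :: complex \<Rightarrow> complex) \<in> borel_measurable borel"
    proof -
      show *: "(rGamma :: complex \<Rightarrow> complex) \<in> borel_measurable borel"
        by (rule borel_measurable_continuous_onI[OF holomorphic_on_imp_continuous_on[OF holomorphic_rGamma]])
      have "(\<lambda>z :: complex. inverse (rGamma z)) \<in> borel_measurable borel"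
        using * by measurable
      then show "(Gamma :: complex \<Rightarrow> complex) \<in> borel_measurable borel"
        by (simp add: Gamma_def[abs_def])
    qed
    note [measurable] = Gm
    have [measurable]: "GG k \<in> borel_measurable borel" for k unfolding GG_def by measurable
    have GG0: "GG 0 = G"
    proof
      fix \<sigma> show "GG 0 \<sigma> = G \<sigma>"
        using Gamma_nonzero[OF pos, of \<sigma>] by (cases "G \<sigma> = 0") (simp_all add: GG_def rGamma_inverse_Gamma)
    qed
    have GG_pos: "Re (v \<sigma>) > 0" if "GG k \<sigma> \<noteq> 0" for k \<sigma>
      by (rule pos) (use that in \<open>simp add: GG_def\<close>)
    have GG_pos': "Re (v \<sigma> + of_nat k) > 0" if "GG k \<sigma> \<noteq> 0" for k \<sigma>
      using GG_pos[OF that] by simp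
    \<comment> \<open>Integrating a power of exponent v + k - 1 once divides by v + k, which is the
      factor Beta 1 (v + k) and the quotient of consecutive Gamma values.\<close>
    have GG_Suc: "GG (Suc k) = (\<lambda>\<sigma>. GG k \<sigma> * Beta 1 (v \<sigma> + of_nat k))" for k
    proof
      fix \<sigma>
      show "GG (Suc k) \<sigma> = GG k \<sigma> * Beta 1 (v \<sigma> + of_nat k)"
      proof (cases "G \<sigma> = 0")
        case False
        have "Gamma (v \<sigma> + of_nat k) \<noteq> 0" using pos[OF False] by (intro Gamma_nonzero) simp
        then show ?thesis
          by (simp add: GG_def Beta_altdef rGamma_inverse_Gamma add_ac)
      qed (simp add: GG_def)
    qed
    have shift: "(\<lambda>\<sigma>. v \<sigma> + of_nat (Suc k)) = (\<lambda>\<sigma>. v \<sigma> + of_nat k + 1)" for k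
      by (simp add: add_ac)
    have weight: "mixture_weight (GG k) (\<lambda>\<sigma>. v \<sigma> + of_nat k) S < \<infinity>" if S: "S > 0" for k S
    proof (induction k)
      case 0 then show ?case using weight0[OF S] by (simp add: GG0)
    next
      case (Suc k)
      show ?case unfolding GG_Suc shift
        by (rule mixture_weight_Beta[OF _ _ GG_pos' _ S Suc]) auto
    qed
    \<comment> \<open>\<open>J k\<close> is the k-fold primitive of the right-hand side: every
      exponent is raised by k.\<close>
    define J where "J = (\<lambda>k. convolution (power_mixture (GG k) (\<lambda>\<sigma>. v \<sigma> + of_nat k)) P)"
    note step = convolution_power_kernel_convolution_power_mixture[OF _ _ P_meas GG_pos' _ _ weight P0 Pint]
    have J_int: "integrable lborel (\<lambda>\<tau>. power_kernel 1 (x - \<tau>) * J k \<tau>)" for k x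
      unfolding J_def by (rule conjunct1[OF step]) (auto dest: GG_pos)
    have J_Suc: "J (Suc k) = convolution (power_kernel 1) (J k)" for k
      unfolding J_def GG_Suc shift by (rule ext, rule conjunct2[OF step, symmetric]) (auto dest: GG_pos)
    have main: "AE x in lborel. (vderiv ^^ r) (J r) x = J 0 x"
      by (rule AE_funpow_vderiv_convolution_power_kernel_one[of J, OF J_Suc J_int r(2)])

    have rhs: "fox_op a w m (n + 2) \<alpha> (\<beta> - \<mu>) A' B' \<phi> = J 0"
    proof -
      have "fox_op a w m (n + 2) \<alpha> (\<beta> - \<mu>) A' B' \<phi> = convolution (power_mixture D2 v) P"
        unfolding D2_def v_def P_def by (rule fox_op_eq_convolution[OF L2 def2 int2 w])
      also have "power_mixture D2 v = power_mixture G v"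
        by (rule power_mixture_AE_cong[OF _ D2_meas _ AE_G, symmetric]) auto
      also have "convolution (power_mixture G v) P = J 0"
        by (simp add: J_def GG0)
      finally show ?thesis .
    qed

    \<comment> \<open>The left-hand side along the same contour\<close>
    define H where "H = (\<lambda>\<sigma>. (1 / Gamma \<mu>) * (G \<sigma> * Beta \<mu> (v \<sigma>)))"
    have [measurable]: "H \<in> borel_measurable borel"
      unfolding H_def Beta_altdef by measurable
    have H_pos: "Re (v \<sigma>) > 0" if "H \<sigma> \<noteq> 0" for \<sigma>
      by (rule pos) (use that in \<open>simp add: H_def\<close>)
    have H_pos': "Re (v \<sigma> + \<mu>) > 0" if "H \<sigma> \<noteq> 0" for \<sigma> using H_pos[OF that] \<mu> by simp
    \<comment> \<open>Writing \<Gamma>(v) / \<Gamma>(v + \<mu>) as Beta \<mu> v / \<Gamma>(\<mu>)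
      brings it within reach of \<open>mixture_weight_Beta\<close>.\<close>
    have H_weight: "mixture_weight H (\<lambda>\<sigma>. v \<sigma> + \<mu>) S < \<infinity>" if S: "S > 0" for S
      unfolding H_def
    proof (rule mixture_weight_scale)
      show "mixture_weight (\<lambda>\<sigma>. G \<sigma> * Beta \<mu> (v \<sigma>)) (\<lambda>\<sigma>. v \<sigma> + \<mu>) S < \<infinity>"
        by (rule mixture_weight_Beta[OF _ _ pos \<mu> S weight0[OF S]]) auto
      show "0 < Re (v \<sigma> + \<mu>)" if "G \<sigma> * Beta \<mu> (v \<sigma>) \<noteq> 0" for \<sigma>
        using pos[of \<sigma>] that \<mu> by simp
    qed (auto simp: Beta_altdef)

    have A': "A' = [(1 - \<beta>, \<alpha>), (1 - (\<beta> + of_nat r - \<mu>), \<alpha>)] @ A"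
      and B': "B' = B @ [(1 - (\<beta> + of_nat r - \<mu>), \<alpha>), (1 - (\<beta> - \<mu>), \<alpha>)]"
      by (simp_all add: A'_def B'_def algebra_simps)
    have L1: "fox_contour m n A B L"
      by (rule fox_contour_mono[OF L2])
        (use fox_left_poles_append fox_right_poles_append[OF m] in \<open>auto simp: A' B' simp del: append.simps\<close>)
    \<comment> \<open>The zeros of the factor \<open>1 / \<Gamma>(v)\<close> may lie on the contour, but only countably many
      parameters hit them because \<open>L\<close> is injective.\<close>
    define X where "X = {\<sigma>. v \<sigma> \<in> \<int>\<^sub>\<le>\<^sub>0}"
    have X: "countable X"
    proof (rule countable_image_inj_on)
      show "countable (v ` X)"
        by (rule countable_subset[of _ "range (of_int :: int \<Rightarrow> complex)"]) (auto simp: X_def nonpos_Ints_def)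
      have "inj L" using L2 by (simp add: fox_contour_def)
      then show "inj_on v X" using \<alpha> by (auto simp: v_def inj_on_def)
    qed
    \<comment> \<open>The poles of \<Gamma>(v + \<mu>) and \<Gamma>(v + r) are left poles, coming
      from the first two entries of \<open>A'\<close>, so these factors are nonzero on the contour.
      Only \<Gamma>(v) can take the default value 0, namely on \<open>X\<close>.\<close>
    have D1_eq: "D2 \<sigma> * (Gamma (v \<sigma>) * rGamma (v \<sigma> + \<mu>)) = D1 \<sigma>" if "\<sigma> \<notin> X" for \<sigma>
    proof -
      have avoid: "L \<sigma> \<notin> fox_left_poles (n + 2) A'" by (rule fox_contour_avoids_left_poles[OF L2])
      have "\<beta> + of_real \<alpha> * L \<sigma> \<noteq> - of_nat k" for k
      proof
        assume "\<beta> + of_real \<alpha> * L \<sigma> = - of_nat k"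
        then have "L \<sigma> \<in> fox_left_poles (n + 2) A'"
          by (intro fox_left_polesI[of 0 _ _ _ k]) (simp_all add: A' algebra_simps)
        with avoid show False ..
      qed
      then have 1: "Gamma (\<beta> + of_real \<alpha> * L \<sigma>) \<noteq> 0"
        by (auto simp: Gamma_eq_zero_iff elim!: nonpos_Ints_cases')
      have "\<beta> + of_nat r - \<mu> + of_real \<alpha> * L \<sigma> \<noteq> - of_nat k" for k
      proof
        assume "\<beta> + of_nat r - \<mu> + of_real \<alpha> * L \<sigma> = - of_nat k"
        then have "L \<sigma> \<in> fox_left_poles (n + 2) A'"
          by (intro fox_left_polesI[of 1 _ _ _ k]) (simp_all add: A' algebra_simps)
        with avoid show False ..
      qed
      then have 2: "Gamma (\<beta> + of_nat r - \<mu> + of_real \<alpha> * L \<sigma>) \<noteq> 0"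
        by (auto simp: Gamma_eq_zero_iff elim!: nonpos_Ints_cases')
      have 3: "Gamma (\<beta> - \<mu> + of_real \<alpha> * L \<sigma>) \<noteq> 0"
        using that by (simp add: Gamma_eq_zero_iff X_def v_def)
      have v\<mu>: "v \<sigma> + \<mu> = \<beta> + of_real \<alpha> * L \<sigma>" by (simp add: v_def)
      show ?thesis
        unfolding D1_def D2_def fox_density_def fox_integrand_def A' B' fox_phi_append[OF m] v\<mu> v_def rGamma_inverse_Gamma
        using 1 2 3 by (simp add: field_simps)
    qed
    \<comment> \<open>The integrability assumed for the left-hand side may concern another contour,
      so measurability along \<open>L\<close> is inherited from \<open>D2\<close> off the countable
      set \<open>X\<close>.\<close>
    have D1_meas [measurable]: "D1 \<in> borel_measurable borel"
      by (rule measurable_discrete_difference[where X = X and f = "\<lambda>\<sigma>. D2 \<sigma> * (Gamma (v \<sigma>) * rGamma (v \<sigma> + \<mu>))"])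
        (use X D1_eq in auto)
    have AE_H: "AE \<sigma> in lborel. H \<sigma> = D1 \<sigma>"
    proof -
      have "AE \<sigma> in lborel. \<sigma> \<notin> X"
        by (rule AE_discrete_difference[OF X]) auto
      with AE_G show ?thesis
      proof eventually_elim
        case (elim \<sigma>)
        have "H \<sigma> = G \<sigma> * (Gamma (v \<sigma>) * rGamma (v \<sigma> + \<mu>))"
          using Gamma_nonzero[OF \<mu>] by (simp add: H_def Beta_altdef add.commute)
        with elim D1_eq show ?case by simp
      qed
    qed
    have int1: "integrable lborel (fox_integrand m n A B L (w * of_real (s powr \<alpha>)))" if s: "s > 0" for s
    proof -
      \<comment> \<open>The constant that undoes the normalization of \<open>fox_density\<close> and
        the factor s powr (\<beta> - 1).\<close>
      let ?K = "2 * of_real pi * \<i> / of_real s powr (\<beta> - 1)"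
      have "integrable lborel (\<lambda>\<sigma>. ?K * (H \<sigma> * power_kernel (v \<sigma> + \<mu>) s))"
        by (intro integrable_mult_right integrable_power_mixture[OF _ _ H_pos' s H_weight[OF s]]) auto
      then have "integrable lborel (\<lambda>\<sigma>. ?K * (D1 \<sigma> * power_kernel (v \<sigma> + \<mu>) s))"
      proof (rule integrable_cong_AE_imp)
        show "AE \<sigma> in lborel. ?K * (H \<sigma> * power_kernel (v \<sigma> + \<mu>) s) = ?K * (D1 \<sigma> * power_kernel (v \<sigma> + \<mu>) s)"
          using AE_H by eventually_elim simp
      qed measurable
      also have "(\<lambda>\<sigma>. ?K * (D1 \<sigma> * power_kernel (v \<sigma> + \<mu>) s)) = fox_integrand m n A B L (w * of_real (s powr \<alpha>))"
      proof
        fix \<sigma>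
        have "power_kernel (v \<sigma> + \<mu>) s = of_real s powr (\<beta> - 1) * of_real s powr (of_real \<alpha> * L \<sigma>)"
        proof -
          have "v \<sigma> + \<mu> = \<beta> + of_real \<alpha> * L \<sigma>" by (simp add: v_def)
          then show ?thesis
            using power_kernel_add[OF s, of \<beta> "of_real \<alpha> * L \<sigma>"] power_kernel_eq_powr[OF s, of \<beta>] by simp
        qed
        then show "?K * (D1 \<sigma> * power_kernel (v \<sigma> + \<mu>) s) = fox_integrand m n A B L (w * of_real (s powr \<alpha>)) \<sigma>"
          using s by (simp add: D1_def fox_density_def fox_integrand_scale[OF s w])
      qed
      finally show ?thesis .
    qed
    have lhs: "fox_op a w m n \<alpha> \<beta> A B \<phi> = convolution (power_mixture H (\<lambda>\<sigma>. v \<sigma> + \<mu>)) P"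
    proof -
      have "(\<lambda>\<sigma>. v \<sigma> + \<mu>) = (\<lambda>\<sigma>. \<beta> + of_real \<alpha> * L \<sigma>)" by (simp add: v_def)
      then have "fox_op a w m n \<alpha> \<beta> A B \<phi> = convolution (power_mixture D1 (\<lambda>\<sigma>. v \<sigma> + \<mu>)) P"
        unfolding D1_def P_def by (simp only: fox_op_eq_convolution[OF L1 def1 int1 w])
      also have "power_mixture D1 (\<lambda>\<sigma>. v \<sigma> + \<mu>) = power_mixture H (\<lambda>\<sigma>. v \<sigma> + \<mu>)"
        by (rule power_mixture_AE_cong[OF _ D1_meas _ AE_H, symmetric]) auto
      finally show ?thesis .
    qed
    have "rl_integral (of_nat r - \<mu>) a (fox_op a w m n \<alpha> \<beta> A B \<phi>) = J r"
    proof
      fix x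
      have "rl_integral (of_nat r - \<mu>) a (fox_op a w m n \<alpha> \<beta> A B \<phi>) x
        = 1 / Gamma (of_nat r - \<mu>) * convolution (power_kernel (of_nat r - \<mu>)) (convolution (power_mixture H (\<lambda>\<sigma>. v \<sigma> + \<mu>)) P) x"
        unfolding lhs by (rule rl_integral_eq_convolution) (auto intro: convolution_eq_0 P0)
      also have "convolution (power_kernel (of_nat r - \<mu>)) (convolution (power_mixture H (\<lambda>\<sigma>. v \<sigma> + \<mu>)) P) x
        = convolution (power_mixture (\<lambda>\<sigma>. H \<sigma> * Beta (of_nat r - \<mu>) (v \<sigma> + \<mu>)) (\<lambda>\<sigma>. v \<sigma> + \<mu> + (of_nat r - \<mu>))) P x"
        \<comment> \<open>The exponents add up to v + r; Re v > 0 and r \<ge> 1 give the condition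
          \<open>ge1\<close>.\<close>
        using r(2) by (intro conjunct2[OF convolution_power_kernel_convolution_power_mixture[OF _ _ P_meas H_pos' r\<mu> _ H_weight P0 Pint]]) (auto dest: H_pos)
      \<comment> \<open>The factor \<Gamma>(v + \<mu>) divides in \<open>H\<close> and multiplies in
        the Beta function. What remains besides \<open>GG r\<close> is \<Gamma>(r - \<mu>), the
        normalization of the fractional integral.\<close>
      also have "(\<lambda>\<sigma>. H \<sigma> * Beta (of_nat r - \<mu>) (v \<sigma> + \<mu>)) = (\<lambda>\<sigma>. Gamma (of_nat r - \<mu>) * GG r \<sigma>)"
      proof
        fix \<sigma>
        show "H \<sigma> * Beta (of_nat r - \<mu>) (v \<sigma> + \<mu>) = Gamma (of_nat r - \<mu>) * GG r \<sigma>"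
        proof (cases "G \<sigma> = 0")
          case False
          have "Gamma (v \<sigma> + \<mu>) \<noteq> 0" using pos[OF False] \<mu> by (intro Gamma_nonzero) simp
          then show ?thesis
            using Gamma_nonzero[OF \<mu>]
            by (simp add: H_def GG_def Beta_altdef rGamma_inverse_Gamma add.commute)
        qed (simp add: H_def GG_def)
      qed
      finally show "rl_integral (of_nat r - \<mu>) a (fox_op a w m n \<alpha> \<beta> A B \<phi>) x = J r x"
        using Gamma_nonzero[OF r\<mu>] by (simp add: convolution_power_mixture_cmult J_def)
    qed
    then have "rl_derivative \<mu> a (fox_op a w m n \<alpha> \<beta> A B \<phi>) = (vderiv ^^ r) (J r)"
      by (simp add: rl_derivative_def r(1))
    then show ?thesis
      using main rhs by (auto elim!: eventually_mono)
  qed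
qed

end
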